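(* For $m\in\{3,4\}$ and any edge probability measure $\mu$, \[ 2m\cdot\beta(\mu;C_m)+\beta(\mu;P_{m+1})\le\frac{2}{m^{m-1}}, \] with equality if and only if $\mu$ is the uniform distribution on the edge set of a copy of $C_m$ (in the underlying complete graph).
   Context: $C_k$ is the cycle on $k$ vertices and $P_k$ the path on $k$ vertices. An edge probability measure is a probability measure $\mu$ on the edge set $E(K)$ of some finite complete graph $K$. For a subgraph $H'\subseteq K$, $\mu(H')=\prod_{e\in E(H')}\mu(e)$, and $\beta(\mu;H)=\sum_{H'}\mu(H')$, the sum over all (unlabeled, not necessarily induced) subgraphs $H'$ of $K$ isomorphic to $H$. *)

theory Defs
  imports Complex_Main
begin

definition Kedges :: "'a set \<Rightarrow> 'a set set" where
  "Kedges V = {e. \<exists>x y. x \<in> V \<and> y \<in> V \<and> x \<noteq> y \<and> e = {x, y}}"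

definition edge_prob_measure :: "'a set \<Rightarrow> ('a set \<Rightarrow> real) \<Rightarrow> bool" where
  "edge_prob_measure V \<mu> \<longleftrightarrow> finite V \<and> (\<forall>e \<in> Kedges V. 0 \<le> \<mu> e) \<and> (\<Sum>e \<in> Kedges V. \<mu> e) = 1"

definition is_cycle_copy :: "'a set \<Rightarrow> nat \<Rightarrow> 'a set set \<Rightarrow> bool" where
  "is_cycle_copy V m S \<longleftrightarrow> (\<exists>f. inj_on f {0..<m} \<and> f ` {0..<m} \<subseteq> V \<and>
      S = (\<lambda>i. {f i, f ((i + 1) mod m)}) ` {0..<m})"

definition is_path_copy :: "'a set \<Rightarrow> nat \<Rightarrow> 'a set set \<Rightarrow> bool" where
  "is_path_copy V k S \<longleftrightarrow> (\<exists>f. inj_on f {0..<k} \<and> f ` {0..<k} \<subseteq> V \<and>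
      S = (\<lambda>i. {f i, f (i + 1)}) ` {0..<k - 1})"

text \<open>beta(mu; H): sum over all (unlabeled) subgraphs isomorphic to H, identified by their
  edge sets, of the product of edge weights.\<close>
definition beta :: "'a set \<Rightarrow> ('a set \<Rightarrow> real) \<Rightarrow> ('a set set \<Rightarrow> bool) \<Rightarrow> real" where
  "beta V \<mu> copy = (\<Sum>S \<in> {S. S \<subseteq> Kedges V \<and> copy S}. \<Prod>e \<in> S. \<mu> e)"

end

theory Submission
  imports Defs "HOL-Analysis.Analysis"
begin

text \<open>
  The left-hand side is a homogeneous polynomial of degree \<open>m\<close> in the edge weights and affine in each of
  them, so it has a maximiser \<open>\<nu>\<close> on the simplex. Shifting mass between two edges shows that at \<open>\<nu>\<close> the partial
  derivative at an edge of positive weight dominates all the others, hence, by Euler's identity, is at least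
  \<open>m\<close> times the maximum. It therefore suffices to bound the derivative at a single edge \<open>u v\<close>, and a heaviest
  edge is taken: a heavy \<open>u v\<close> leaves little mass for the rest of a cycle or path through it, while
  if \<open>u v\<close> is light then so is every edge of the cycle. Any measure that attains the bound is a maximiser
  itself, so the equality case of the derivative estimate settles the equality case of the theorem.
\<close>

text \<open>Both graphs have \<open>m\<close> edges, which makes the form homogeneous, and
  \<open>P_(m+1)\<close> has one vertex too many to lie inside \<open>C_m\<close>. So at the uniform
  weighting of a cycle only the cycle term survives, and the derivative at one of its edges is
  \<open>2 * m\<close> times \<open>m - 1\<close> factors \<open>1 / m\<close>: exactly the target
  \<open>m * (2 / m ^ (m - 1))\<close>. The choice of the edge matters. For \<open>m = 3\<close> and
  weight 1/2 on each of \<open>u x\<close> and \<open>v x\<close>, the derivative at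
  \<open>u v\<close> is 6 * 1/4 = 3/2, above the target 2/3. At a heaviest edge the estimate holds
  for every probability weighting, optimal or not. The path sums contain no path that would close up
  into a cycle. This omission lowers the cycle coefficient by one, from 6 to 5 for
  \<open>m = 3\<close> and from 8 to 7 for \<open>m = 4\<close>. Without the saving the polynomial
  bounds would already fail at the extremal point.\<close>

section \<open>Polynomial inequalities\<close>

text \<open>
  In both polynomial bounds \<open>W + 2 * h + R\<close> is the total mass, made homogeneous. Here \<open>W\<close> is the weight of
  the heaviest edge \<open>u v\<close>, \<open>2 * h\<close> the mass of the edges meeting exactly one of \<open>u\<close>, \<open>v\<close>, and \<open>R\<close> the rest.
  \<open>X\<close> stands for the cycle sum, \<open>M\<close> for the largest weight among the remaining edges, and \<open>E\<close> for a bound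
  on two-step walks among them. Each case is chosen so that, in terms of the gaps of the ordering it fixes,
  the difference of the two sides has nonnegative coefficients.
\<close>

lemma cubic_bound:
  fixes W h R M E X :: real
  assumes M: "0 \<le> M" "M \<le> W" "M \<le> R" and h: "0 \<le> h" and pos: "0 < W"
    and E1: "E \<le> R\<^sup>2 / 4" and E2: "R \<le> 2 * M \<Longrightarrow> E \<le> M * (R - M)"
    and X1: "X \<le> M * h\<^sup>2" and X2: "X \<le> W * h * R"
    and X3: "R \<le> 2 * M \<Longrightarrow> X \<le> (2 * M - R) * W * h + (R - M) * h\<^sup>2"
  shows "8 * (7 * X + h\<^sup>2 * R + 2 * h * E) \<le> (W + 2 * h + R) ^ 3" (is "?L \<le> ?T")
    and "8 * (7 * X + h\<^sup>2 * R + 2 * h * E) = (W + 2 * h + R) ^ 3 \<Longrightarrow> M = W \<and> R = W \<and> h = W"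
proof -
  have hE1: "2 * h * E \<le> h * R\<^sup>2 / 2"
    using mult_left_mono[OF E1 h] by simp
  have hE2: "2 * h * E \<le> 2 * h * (M * (R - M))" if "R \<le> 2 * M"
    using mult_left_mono[OF E2[OF that] h] by simp
  \<comment> \<open>The condition \<open>R \<le> 2 * M\<close> decides whether \<open>E2\<close> and
    \<open>X3\<close> are available. The extremal point \<open>M = W = R = h\<close> lies in
    \<open>medium\<close> only, so every other case shows strict inequality.\<close>
  consider (small) "h \<le> 2 * (R - M)"
    | (split) "2 * (R - M) < h" "2 * M < R"
    | (medium) "2 * (R - M) < h" "R \<le> 2 * M" "h \<le> R"
    | (large1) "R \<le> 2 * M" "R < h" "h - R \<le> W - M"
    | (large2) "R \<le> 2 * M" "R < h" "W - M < h - R"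
    by linarith
  then have "?L \<le> ?T \<and> (?L = ?T \<longrightarrow> M = W \<and> R = W \<and> h = W)"
  proof cases
    case small
    define b c where "b = W - M" and "c = R - M - h / 2"
    have nn: "0 \<le> b" "0 \<le> c" using M small by (auto simp: b_def c_def)
    have W: "W = M + b" and R: "R = M + c + h / 2" by (auto simp: b_def c_def)
    \<comment> \<open>The expansion has one negative coefficient, that of \<open>M * h^2\<close>.
      The part in \<open>M\<close> and \<open>h\<close> alone is
      \<open>h * (26 * M^2 - 61/2 * M * h + 85/8 * h^2)\<close>, and completing the square gives
      61/104 and the remainder 699/416. The terms \<open>8 * M^3 + b^3\<close> are set aside for
      strictness: \<open>M\<close> and \<open>b\<close> cannot both vanish, as
      \<open>W > 0\<close>.\<close>
    have "?T - 8 * (7 * (M * h\<^sup>2) + h\<^sup>2 * R + h * R\<^sup>2 / 2) = 8 * M^3 + b^3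
       + (12*M^2*b + 12*M^2*c + 6*M*b^2 + 12*M*b*c + 30*M*b*h + 6*M*c^2 + 22*M*c*h
       + 3*b^2*c + 15/2*b^2*h + 3*b*c^2 + 15*b*c*h + 75/4*b*h^2 + c^3 + 7/2*c^2*h
       + 27/4*c*h^2 + 26 * (h * (M - 61/104 * h)\<^sup>2) + 699/416 * h^3)" (is "_ = _ + ?rest")
      unfolding W R by (simp add: field_simps power2_eq_square power3_eq_cube)
    moreover have "0 \<le> ?rest"
      using nn M h by (intro add_nonneg_nonneg mult_nonneg_nonneg zero_le_power2 zero_le_power) auto
    moreover have "0 < 8 * M^3 + b^3"
      using pos M nn W by (cases "M = 0") (auto intro!: add_pos_nonneg)
    ultimately show ?thesis using X1 hE1 by argo
  next
    case split
    define b c d where "b = W - M" and "c = R - 2 * M" and "d = h - 2 * (R - M)"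
    have nn: "0 \<le> b" "0 < c" "0 \<le> d" using M split by (auto simp: b_def c_def d_def)
    have W: "W = M + b" and h': "h = 2 * M + 2 * c + d" and R: "R = 2 * M + c"
      by (auto simp: b_def c_def d_def)
    \<comment> \<open>Here and below \<open>X\<close> is replaced by the mean of two of its upper
      bounds. \<open>M * h^2\<close> is good for small \<open>h\<close> and \<open>W * h * R\<close>
      for large \<open>h\<close>, and the mean balances them in one polynomial.\<close>
    have "?T - 8 * (7 * ((M * h\<^sup>2 + W * h * R) / 2) + h\<^sup>2 * R + h * R\<^sup>2 / 2) = 85*c^3
      + (23*M^3 + 35*M^2*b + 119*M^2*c + 46*M^2*d + 21*M*b^2 + 42*M*b*c + 28*M*b*d + 189*M*c^2
      + 168*M*c*d + 40*M*d^2 + b^3 + 15*b^2*c + 6*b^2*d + 19*b*c^2 + 32*b*c*d + 12*b*d^2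
      + 114*c^2*d + 52*c*d^2 + 8*d^3)" (is "_ = _ + ?rest")
      unfolding W h' R by (simp add: field_simps power2_eq_square power3_eq_cube)
    moreover have "0 \<le> ?rest"
      using nn M h by (intro add_nonneg_nonneg mult_nonneg_nonneg zero_le_power) auto
    moreover have "0 < 85 * c^3" using nn by simp
    ultimately show ?thesis using X1 X2 hE1 by argo
  next
    case medium
    define a b c d where "a = R - M" and "b = R - h" and "c = W - M" and "d = h - 2 * (R - M)"
    have nn: "0 \<le> a" "0 \<le> b" "0 \<le> c" "0 < d"
      using M medium by (auto simp: a_def b_def c_def d_def)
    have W: "W = a + b + c + d" and h': "h = 2 * a + d" and R: "R = 2 * a + b + d"
      and M': "M = a + b + d"
      by (auto simp: a_def b_def c_def d_def)
    \<comment> \<open>Part of the \<open>d^2\<close> terms is split off to settle equality: as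
      \<open>d > 0\<close>, it vanishes only for \<open>a = b = c = 0\<close>, and then all four of
      \<open>W\<close>, \<open>h\<close>, \<open>R\<close>, \<open>M\<close> equal
      \<open>d\<close>.\<close>
    have "?T - 8 * (7 * ((M * h\<^sup>2 + (2 * M - R) * W * h + (R - M) * h\<^sup>2) / 2) + h\<^sup>2 * R
        + 2 * h * (M * (R - M))) = 4 * (a + b + c) * d^2
      + (23*a^3 + 62*a^2*b + 147*a^2*c + 52*a^2*d + 28*a*b^2 + 28*a*b*c + 36*a*b*d + 21*a*c^2
      + 112*a*c*d + 16*a*d^2 + 8*b^3 + 12*b^2*c + 20*b^2*d + 6*b*c^2 + 20*b*c*d
      + c^3 + 12*c^2*d + 16*c*d^2)" (is "_ = _ + ?rest")
      unfolding W h' R M' by (simp add: field_simps power2_eq_square power3_eq_cube)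
    moreover have "0 \<le> ?rest"
      using nn by (intro add_nonneg_nonneg mult_nonneg_nonneg zero_le_power) auto
    moreover have "0 \<le> 4 * (a + b + c) * d^2" using nn by simp
    ultimately have *: "?L \<le> ?T" "?L = ?T \<Longrightarrow> 4 * (a + b + c) * d^2 = 0"
      using X1 X3 medium hE2 by argo+
    have "a + b + c = 0" if "?L = ?T" using *(2)[OF that] nn by simp
    then have "a = 0 \<and> b = 0 \<and> c = 0" if "?L = ?T" using that nn by linarith
    then show ?thesis using *(1) by (auto simp: W h' R M')
  next
    case large1
    define a b c d where "a = R - M" and "b = 2 * M - R" and "c = W - M - (h - R)" and "d = h - R"
    have nn: "0 \<le> a" "0 \<le> b" "0 \<le> c" "0 < d"
      using M large1 by (auto simp: a_def b_def c_def d_def)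
    have W: "W = a + b + c + d" and h': "h = 2 * a + b + d" and R: "R = 2 * a + b"
      and M': "M = a + b"
      by (auto simp: a_def b_def c_def d_def)
    have "?T - 8 * (7 * ((M * h\<^sup>2 + (2 * M - R) * W * h + (R - M) * h\<^sup>2) / 2) + h\<^sup>2 * R
        + 2 * h * (M * (R - M))) = 27*d^3
      + (23*a^3 + 52*a^2*b + 147*a^2*c + 137*a^2*d + 20*a*b^2 + 112*a*b*c + 116*a*b*d + 21*a*c^2
      + 126*a*c*d + 117*a*d^2 + 20*b^2*c + 16*b^2*d + 12*b*c^2 + 44*b*c*d + 44*b*d^2 + c^3
      + 9*c^2*d + 27*c*d^2)" (is "_ = _ + ?rest")
      unfolding W h' R M' by (simp add: field_simps power2_eq_square power3_eq_cube)
    moreover have "0 \<le> ?rest"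
      using nn by (intro add_nonneg_nonneg mult_nonneg_nonneg zero_le_power) auto
    moreover have "0 < 27 * d^3" using nn by simp
    ultimately show ?thesis using X1 X3 large1 hE2 by argo
  next
    case large2
    define a b c d where "a = R - M" and "b = 2 * M - R" and "c = W - M" and "d = h - R - (W - M)"
    have nn: "0 \<le> a" "0 \<le> b" "0 \<le> c" "0 < d"
      using M large2 by (auto simp: a_def b_def c_def d_def)
    have W: "W = a + b + c" and h': "h = 2 * a + b + c + d" and R: "R = 2 * a + b"
      and M': "M = a + b"
      by (auto simp: a_def b_def c_def d_def)
    have "?T - 8 * (7 * ((W * h * R + (2 * M - R) * W * h + (R - M) * h\<^sup>2) / 2) + h\<^sup>2 * R
        + 2 * h * (M * (R - M))) = 8*d^3
      + (23*a^3 + 52*a^2*b + 81*a^2*c + 46*a^2*d + 20*a*b^2 + 88*a*b*c + 88*a*b*d + 89*a*c^2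
      + 108*a*c*d + 40*a*d^2 + 16*b^2*c + 24*b^2*d + 44*b*c^2 + 72*b*c*d + 40*b*d^2 + 27*c^3
      + 54*c^2*d + 36*c*d^2)" (is "_ = _ + ?rest")
      unfolding W h' R M' by (simp add: field_simps power2_eq_square power3_eq_cube)
    moreover have "0 \<le> ?rest"
      using nn by (intro add_nonneg_nonneg mult_nonneg_nonneg zero_le_power) auto
    moreover have "0 < 8 * d^3" using nn by simp
    ultimately show ?thesis using X2 X3 large2 hE2 by argo
  qed
  then show "?L \<le> ?T" "?L = ?T \<Longrightarrow> M = W \<and> R = W \<and> h = W" by auto
qed

text \<open>\<open>X1\<close> is the better bound on \<open>X\<close> for \<open>h \<le> W\<close>
  and \<open>X2\<close> beyond; the crossover \<open>h = W\<close> is the extremal point. At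
  equality \<open>X = h^2\<close> is recorded as well, because it is what forces the mass at
  \<open>u\<close> and at \<open>v\<close> onto a common third vertex.\<close>

lemma square_bound:
  fixes W h R X :: real
  assumes nn: "0 \<le> h" "0 \<le> R" "0 < W" and X1: "X \<le> h\<^sup>2" and X2: "X \<le> W * h"
  shows "3 * (5 * X + h\<^sup>2 + 2 * h * R) \<le> 2 * (W + 2 * h + R)\<^sup>2" (is "?L \<le> ?T")
    and "3 * (5 * X + h\<^sup>2 + 2 * h * R) = 2 * (W + 2 * h + R)\<^sup>2 \<Longrightarrow> R = 0 \<and> h = W \<and> X = h\<^sup>2"
proof -
  have "?L \<le> ?T \<and> (?L = ?T \<longrightarrow> R = 0 \<and> h = W \<and> X = h\<^sup>2)"
  proof (cases "h \<le> W")
    case True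
    have "?T - 3 * (6 * h\<^sup>2 + 2 * h * R) = 2 * (W - h + R)\<^sup>2 + 6 * h * (2 * (W - h) + R)"
      by (simp add: field_simps power2_eq_square)
    moreover have "0 \<le> 6 * h * (2 * (W - h) + R)" using nn True by simp
    moreover have "0 \<le> 2 * (W - h + R)\<^sup>2" by simp
    ultimately have *: "?L \<le> ?T" "?L = ?T \<Longrightarrow> 2 * (W - h + R)\<^sup>2 = 0 \<and> X = h\<^sup>2"
      using X1 by argo+
    then have "W - h + R = 0" if "?L = ?T" using that by simp
    then show ?thesis using * True nn by (smt (verit))
  next
    case False
    have "?T - 3 * (5 * (W * h) + h\<^sup>2 + 2 * h * R)
        = 2 * R\<^sup>2 + 6 * W * R + 5 * (h - W)\<^sup>2 + 3 * W * (h - W) + 2 * (h - W) * R"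
      by (simp add: field_simps power2_eq_square)
    moreover have "0 \<le> 2 * R\<^sup>2" "0 \<le> 6 * W * R" "0 \<le> 5 * (h - W)\<^sup>2" "0 \<le> 2 * (h - W) * R"
        "0 < 3 * W * (h - W)"
      using nn False by auto
    ultimately show ?thesis using X2 by argo
  qed
  then show "?L \<le> ?T" "?L = ?T \<Longrightarrow> R = 0 \<and> h = W \<and> X = h\<^sup>2" by auto
qed

section \<open>Maximising a multi-affine form over the simplex\<close>

definition multilin :: "'b set \<Rightarrow> ('b set \<Rightarrow> real) \<Rightarrow> ('b \<Rightarrow> real) \<Rightarrow> real" where
  "multilin E c w = (\<Sum>S\<in>Pow E. c S * prod w S)"

definition multilin_deriv :: "'b set \<Rightarrow> ('b set \<Rightarrow> real) \<Rightarrow> 'b \<Rightarrow> ('b \<Rightarrow> real) \<Rightarrow> real" where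
  "multilin_deriv E c e w = (\<Sum>S\<in>Pow E. if e \<in> S then c S * prod w (S - {e}) else 0)"

text \<open>The weights are pinned to 0 outside \<open>E\<close>, since otherwise the free
  coordinates would make the set noncompact in the product topology.\<close>

definition prob_weights :: "'b set \<Rightarrow> ('b \<Rightarrow> real) set" where
  "prob_weights E = {w. (\<forall>e\<in>E. 0 \<le> w e) \<and> sum w E = 1 \<and> (\<forall>e. e \<notin> E \<longrightarrow> w e = 0)}"

text \<open>By Tychonoff: the set is a closed slice of a product of compact intervals, almost all of
  which may be the single point 0.\<close>

lemma compact_prob_weights:
  fixes E :: "'b set"
  assumes "finite E"
  shows "compact (prob_weights E)"
proof -
  let ?B = "PiE UNIV (\<lambda>e. if e \<in> E then {0..1::real} else {0})"
  have "compactin (product_topology (\<lambda>_. euclidean) UNIV) ?B"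
    by (simp add: compactin_PiE)
  then have "compact ?B"
    by (simp add: euclidean_product_topology)
  moreover have "closed {w :: 'b \<Rightarrow> real. sum w E = 1}"
    by (intro closed_Collect_eq continuous_intros) simp_all
  moreover have "prob_weights E = ?B \<inter> {w. sum w E = 1}"
  proof (intro equalityI subsetI)
    fix w assume w: "w \<in> prob_weights E"
    have "w e \<le> 1" if "e \<in> E" for e
      using member_le_sum[of e E w] w that assms by (auto simp: prob_weights_def)
    then show "w \<in> ?B \<inter> {w. sum w E = 1}"
      using w by (auto simp: prob_weights_def)
  next
    fix w assume "w \<in> ?B \<inter> {w. sum w E = 1}"
    then have w: "w e \<in> (if e \<in> E then {0..1} else {0})" "sum w E = 1" for e
      by (auto simp: PiE_iff)
    have "0 \<le> w e" if "e \<in> E" for e using w(1)[of e] that by simp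
    moreover have "w e = 0" if "e \<notin> E" for e using w(1)[of e] that by simp
    ultimately show "w \<in> prob_weights E"
      using w(2) by (auto simp: prob_weights_def)
  qed
  ultimately show ?thesis
    by (simp add: compact_Int_closed)
qed

lemma multilin_attains_max:
  assumes "finite E" "w0 \<in> prob_weights E"
  obtains w where "w \<in> prob_weights E" "\<And>v. v \<in> prob_weights E \<Longrightarrow> multilin E c v \<le> multilin E c w"
proof -
  have "continuous_on (prob_weights E) (multilin E c)"
    unfolding multilin_def
    by (intro continuous_intros continuous_on_product_coordinates[THEN continuous_on_subset]) simp_all
  then show ?thesis
    using continuous_attains_sup[OF compact_prob_weights[OF assms(1)]] assms(2) that by blast
qed

text \<open>Multiplying by \<open>w e\<close> restores each monomial that contains \<open>e\<close>,
  so every \<open>S\<close> is counted \<open>card S = m\<close> times.\<close>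

lemma multilin_euler:
  assumes "finite E" and hom: "\<And>S. S \<subseteq> E \<Longrightarrow> c S \<noteq> 0 \<Longrightarrow> card S = m"
  shows "(\<Sum>e\<in>E. w e * multilin_deriv E c e w) = m * multilin E c w"
proof -
  have "(\<Sum>e\<in>E. w e * multilin_deriv E c e w)
      = (\<Sum>S\<in>Pow E. \<Sum>e\<in>E. if e \<in> S then c S * prod w S else 0)"
    unfolding multilin_deriv_def sum_distrib_left
  proof (subst sum.swap, intro sum.cong refl)
    fix S e assume "S \<in> Pow E" "e \<in> E"
    then have "finite S" using assms(1) finite_subset by auto
    then show "w e * (if e \<in> S then c S * prod w (S - {e}) else 0) = (if e \<in> S then c S * prod w S else 0)"
      by (simp add: prod.remove)
  qed
  also have "\<dots> = (\<Sum>S\<in>Pow E. m * (c S * prod w S))"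
  proof (intro sum.cong refl)
    fix S assume "S \<in> Pow E"
    then have "(\<Sum>e\<in>E. if e \<in> S then c S * prod w S else 0) = card S * (c S * prod w S)"
      using assms(1) by (simp add: sum.If_cases Int_absorb1)
    with hom \<open>S \<in> Pow E\<close> show "(\<Sum>e\<in>E. if e \<in> S then c S * prod w S else 0) = m * (c S * prod w S)"
      by (cases "c S = 0") auto
  qed
  finally show ?thesis by (simp add: multilin_def sum_distrib_left)
qed

text \<open>Each factor occurs once, so moving \<open>t\<close> from \<open>e\<close> to
  \<open>f\<close> changes a monomial by an exact polynomial in \<open>t\<close> of degree at most
  two, and no calculus is required.\<close>

lemma prod_shift:
  fixes w :: "'b \<Rightarrow> real"
  assumes "finite S" "e \<noteq> f"
  shows "prod (w(e := w e - t, f := w f + t)) S - prod w S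
    = t * ((if f \<in> S then prod w (S - {f}) else 0) - (if e \<in> S then prod w (S - {e}) else 0))
      - t\<^sup>2 * (if e \<in> S \<and> f \<in> S then prod w (S - {e, f}) else 0)"
proof -
  let ?v = "w(e := w e - t, f := w f + t)"
  have rest: "prod ?v (S - {e, f}) = prod w (S - {e, f})"
    by (rule prod.cong) auto
  have eq: "S - {f} - {e} = S - {e, f}" "S - {e} - {f} = S - {e, f}" by auto
  consider "e \<in> S" "f \<in> S" | "e \<in> S" "f \<notin> S" | "e \<notin> S" "f \<in> S" | "e \<notin> S" "f \<notin> S" by auto
  then show ?thesis
  proof cases
    case 1
    have "prod v S = v e * (v f * prod v (S - {e, f}))" for v :: "'b \<Rightarrow> real"
      using 1 assms prod.remove[of S e v] prod.remove[of "S - {e}" f v] eq by simp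
    note S = this
    have "prod w (S - {f}) = w e * prod w (S - {e, f})" "prod w (S - {e}) = w f * prod w (S - {e, f})"
      using 1 assms prod.remove[of "S - {f}" e w] prod.remove[of "S - {e}" f w] eq by simp_all
    then show ?thesis
      unfolding S[of ?v] S[of w] rest using 1 assms
      by (simp add: algebra_simps power2_eq_square)
  next
    case 2
    have "prod ?v (S - {e}) = prod w (S - {e})" using 2 by (intro prod.cong) auto
    then show ?thesis
      using 2 assms prod.remove[of S e ?v] prod.remove[of S e w] by (simp add: algebra_simps)
  next
    case 3
    have "prod ?v (S - {f}) = prod w (S - {f})" using 3 by (intro prod.cong) auto
    then show ?thesis
      using 3 assms prod.remove[of S f ?v] prod.remove[of S f w] by (simp add: algebra_simps)
  next
    case 4
    have "prod ?v S = prod w S" using 4 by (intro prod.cong) auto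
    then show ?thesis using 4 by simp
  qed
qed

lemma multilin_deriv_le_of_max:
  fixes E :: "'b set"
  assumes E: "finite E" and w: "w \<in> prob_weights E"
    and max: "\<And>v. v \<in> prob_weights E \<Longrightarrow> multilin E c v \<le> multilin E c w"
    and e: "e \<in> E" "0 < w e" and f: "f \<in> E"
  shows "multilin_deriv E c f w \<le> multilin_deriv E c e w"
proof (rule ccontr)
  assume contra: "\<not> ?thesis"
  then have ef: "e \<noteq> f" by auto
  define \<delta> where "\<delta> = multilin_deriv E c f w - multilin_deriv E c e w"
  have \<delta>: "0 < \<delta>" using contra by (simp add: \<delta>_def)
  define D where "D = (\<Sum>S\<in>Pow E. c S * (if e \<in> S \<and> f \<in> S then prod w (S - {e, f}) else 0))"
  \<comment> \<open>The first bound keeps the weight of \<open>e\<close> nonnegative; the second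
    makes the quadratic loss \<open>t * D\<close> at most half of the linear gain \<delta>.\<close>
  define t where "t = min (w e) (\<delta> / (2 * (\<bar>D\<bar> + 1)))"
  have t: "0 < t" "t \<le> w e" using e \<delta> by (auto simp: t_def)
  let ?v = "w(e := w e - t, f := w f + t)"
  have "multilin E c ?v - multilin E c w = (\<Sum>S\<in>Pow E. c S * (prod ?v S - prod w S))"
    by (simp add: multilin_def sum_subtractf algebra_simps)
  also have "\<dots> = (\<Sum>S\<in>Pow E. t * (if f \<in> S then c S * prod w (S - {f}) else 0)
      - t * (if e \<in> S then c S * prod w (S - {e}) else 0)
      - t\<^sup>2 * (c S * (if e \<in> S \<and> f \<in> S then prod w (S - {e, f}) else 0)))"
  proof (intro sum.cong refl)
    fix S assume "S \<in> Pow E"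
    then have "finite S" using E finite_subset by auto
    show "c S * (prod ?v S - prod w S) = t * (if f \<in> S then c S * prod w (S - {f}) else 0)
      - t * (if e \<in> S then c S * prod w (S - {e}) else 0)
      - t\<^sup>2 * (c S * (if e \<in> S \<and> f \<in> S then prod w (S - {e, f}) else 0))"
      unfolding prod_shift[OF \<open>finite S\<close> ef] by (simp add: algebra_simps)
  qed
  also have "\<dots> = t * \<delta> - t\<^sup>2 * D"
    by (simp add: \<delta>_def D_def multilin_deriv_def sum_subtractf sum_distrib_left right_diff_distrib)
  finally have eq: "multilin E c ?v - multilin E c w = t * (\<delta> - t * D)"
    by (simp add: algebra_simps power2_eq_square)
  have "sum ?v E = sum w E"
  proof -
    have "sum v E = v e + (v f + sum v (E - {e, f}))" for v :: "'b \<Rightarrow> real"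
      using sum.remove[of E e v] sum.remove[of "E - {e}" f v] E e f ef
      by (simp add: Diff_insert2[symmetric] insert_commute)
    moreover have "sum ?v (E - {e, f}) = sum w (E - {e, f})" by (intro sum.cong) auto
    ultimately show ?thesis using ef by simp
  qed
  then have "?v \<in> prob_weights E"
    using w e f t by (auto simp: prob_weights_def)
  with max have "t * (\<delta> - t * D) \<le> 0" by (smt (verit) eq)
  then have "\<delta> \<le> t * D" using t by (simp add: mult_le_0_iff)
  also have "\<dots> \<le> t * (\<bar>D\<bar> + 1)" using t by (intro mult_left_mono) auto
  also have "\<dots> \<le> \<delta> / (2 * (\<bar>D\<bar> + 1)) * (\<bar>D\<bar> + 1)"
    by (intro mult_right_mono) (auto simp: t_def)
  also have "\<dots> = \<delta> / 2" by (simp add: field_simps)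
  finally show False using \<delta> by simp
qed

lemma multilin_le_deriv_of_max:
  assumes E: "finite E" and hom: "\<And>S. S \<subseteq> E \<Longrightarrow> c S \<noteq> 0 \<Longrightarrow> card S = m"
    and w: "w \<in> prob_weights E"
    and max: "\<And>v. v \<in> prob_weights E \<Longrightarrow> multilin E c v \<le> multilin E c w"
    and e: "e \<in> E" "0 < w e"
  shows "m * multilin E c w \<le> multilin_deriv E c e w"
proof -
  have "m * multilin E c w = (\<Sum>f\<in>E. w f * multilin_deriv E c f w)"
    using multilin_euler[OF E hom] by simp
  also have "\<dots> \<le> (\<Sum>f\<in>E. w f * multilin_deriv E c e w)"
    using w multilin_deriv_le_of_max[OF E w max e]
    by (intro sum_mono mult_left_mono) (auto simp: prob_weights_def)
  also have "\<dots> = multilin_deriv E c e w"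
    using w by (simp add: prob_weights_def flip: sum_distrib_right)
  finally show ?thesis .
qed

section \<open>Weighted cycles and paths through a heaviest edge\<close>

text \<open>
  \<open>U\<close> is the set of vertices off an edge \<open>u v\<close> of maximal weight \<open>W\<close>; \<open>a x\<close> and \<open>b x\<close> are the weights of
  \<open>u x\<close> and \<open>v x\<close>.
\<close>

locale heavy_edge =
  fixes U :: "'a set" and w :: "'a \<Rightarrow> 'a \<Rightarrow> real" and a b :: "'a \<Rightarrow> real" and W :: real
  assumes fin: "finite U"
    and sym: "w x y = w y x" and diag: "w x x = 0" and w_nn: "x \<in> U \<Longrightarrow> y \<in> U \<Longrightarrow> 0 \<le> w x y"
    and a_nn: "x \<in> U \<Longrightarrow> 0 \<le> a x" and b_nn: "x \<in> U \<Longrightarrow> 0 \<le> b x"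
    and w_le: "x \<in> U \<Longrightarrow> y \<in> U \<Longrightarrow> w x y \<le> W"
    and a_le: "x \<in> U \<Longrightarrow> a x \<le> W" and b_le: "x \<in> U \<Longrightarrow> b x \<le> W"
    and W_pos: "0 < W"
    and total: "W + sum a U + sum b U + (\<Sum>x\<in>U. \<Sum>y\<in>U. w x y) / 2 = 1"
begin

abbreviation "A \<equiv> sum a U"
abbreviation "B \<equiv> sum b U"
abbreviation "deg x \<equiv> \<Sum>y\<in>U. w x y"
abbreviation "R \<equiv> (\<Sum>x\<in>U. deg x) / 2"
abbreviation "X3 \<equiv> \<Sum>x\<in>U. a x * b x"
abbreviation "X4 \<equiv> \<Sum>x\<in>U. \<Sum>y\<in>U. a x * w x y * b y"

lemma A_nn: "0 \<le> A" and B_nn: "0 \<le> B" and R_nn: "0 \<le> R"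
  using a_nn b_nn w_nn by (auto intro!: sum_nonneg)

text \<open>Every edge at \<open>x\<close> is counted a second time at its other end, so the degree
  sum is at least \<open>2 * deg x\<close>.\<close>

lemma deg_le: assumes "x \<in> U" shows "deg x \<le> R"
proof -
  have "deg x = (\<Sum>z\<in>U - {x}. w z x)"
    using assms fin by (simp add: sum.remove[of U x] diag sym[of x])
  also have "\<dots> \<le> (\<Sum>z\<in>U - {x}. deg z)"
    using assms fin w_nn by (intro sum_mono member_le_sum) auto
  finally have "deg x + deg x \<le> (\<Sum>z\<in>U. deg z)"
    using assms fin by (simp add: sum.remove[of U x])
  then show ?thesis by simp
qed

text \<open>Inclusion-exclusion: the edges meeting \<open>x\<close> or \<open>y\<close> have weight
  \<open>deg x + deg y - w x y\<close>, a part of the total \<open>R\<close>.\<close>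

lemma deg_pair_le:
  assumes xy: "x \<in> U" "y \<in> U" "x \<noteq> y"
  shows "deg x + deg y \<le> R + w x y"
proof -
  have split: "sum f U = f x + (f y + sum f (U - {x, y}))" for f :: "'a \<Rightarrow> real"
    using sum.remove[of U x f] sum.remove[of "U - {x}" y f] fin xy
    by (simp add: Diff_insert2[symmetric] insert_commute)
  have "deg x - w x y + (deg y - w x y) = (\<Sum>z\<in>U - {x, y}. w z x + w z y)"
    by (simp add: split diag sym[of y x] sum.distrib) (simp add: sym)
  also have "\<dots> \<le> (\<Sum>z\<in>U - {x, y}. deg z)"
  proof (intro sum_mono)
    fix z assume "z \<in> U - {x, y}"
    then have "0 \<le> (\<Sum>y\<in>U - {x, y}. w z y)" using w_nn by (intro sum_nonneg) auto
    then show "w z x + w z y \<le> deg z" by (simp add: split[of "w z"])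
  qed
  finally show ?thesis using split[of deg] by linarith
qed

text \<open>The edge \<open>p q\<close> avoids \<open>x\<close>, so its weight comes on top of
  \<open>deg x\<close> within \<open>R\<close>.\<close>

lemma deg_add_le:
  assumes "x \<in> U" "p \<in> U" "q \<in> U" "p \<noteq> q" "x \<noteq> p" "x \<noteq> q"
  shows "deg x + w p q \<le> R"
proof -
  have "w p x + w p q = sum (w p) {x, q}" using assms by simp
  also have "\<dots> \<le> deg p" using assms fin w_nn by (intro sum_mono2) auto
  finally show ?thesis
    using deg_pair_le[of x p] assms sym[of x p] by simp
qed

lemma product_le_sqr: "A * B \<le> ((A + B) / 2)\<^sup>2"
  using sum_squares_ge_zero[of "A - B" 0] by (simp add: power2_eq_square field_simps)

lemma sum_a_deg_le: "(\<Sum>x\<in>U. a x * deg x) \<le> A * R"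
  unfolding sum_distrib_right using a_nn deg_le by (intro sum_mono mult_left_mono) auto

lemma sum_b_deg_le: "(\<Sum>x\<in>U. b x * deg x) \<le> B * R"
  unfolding sum_distrib_right using b_nn deg_le by (intro sum_mono mult_left_mono) auto

lemma prod_AB: "A * B = (\<Sum>x\<in>U. \<Sum>y\<in>U. a x * b y)"
  by (simp add: sum_product)

lemma sum_off_diag: "(\<Sum>x\<in>U. \<Sum>y\<in>U - {x}. a x * b y) = A * B - X3"
  unfolding prod_AB sum_subtractf[symmetric] using fin
  by (intro sum.cong) (simp_all add: sum_diff1)

text \<open>\<open>D\<close> is what will dominate the derivative at \<open>u v\<close> for
  \<open>m = 3\<close>: triangles, then paths with \<open>u v\<close> in the middle, then paths with
  \<open>u v\<close> at an end. The middle paths leave out the diagonal part \<open>X3\<close> of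
  \<open>A * B\<close>, so \<open>6 * X3\<close> becomes \<open>5 * X3\<close>.\<close>

lemma triangle_bound:
  defines "D \<equiv> 6 * X3 + (\<Sum>x\<in>U. \<Sum>y\<in>U - {x}. a x * b y) + (\<Sum>x\<in>U. \<Sum>y\<in>U. (a x + b x) * w x y)"
  shows "D \<le> 2 / 3"
    and "D = 2 / 3 \<Longrightarrow> W = 1 / 3 \<and> (\<exists>x\<in>U. a x = 1 / 3 \<and> b x = 1 / 3)"
proof -
  define h where "h = (A + B) / 2"
  have h: "0 \<le> h" using A_nn B_nn by (simp add: h_def)
  have XAB: "X3 \<le> A * B"
    unfolding sum_distrib_right using a_nn b_nn fin
    by (intro sum_mono mult_left_mono member_le_sum) auto
  have X1: "X3 \<le> h\<^sup>2" using XAB product_le_sqr by (simp add: h_def)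
  have "X3 \<le> A * W" "X3 \<le> W * B"
    unfolding sum_distrib_right sum_distrib_left using a_nn b_nn a_le b_le
    by (intro sum_mono mult_left_mono mult_right_mono; simp)+
  then have X2: "X3 \<le> W * h" by (simp add: h_def field_simps)
  have "(\<Sum>x\<in>U. \<Sum>y\<in>U. (a x + b x) * w x y) = (\<Sum>x\<in>U. a x * deg x) + (\<Sum>x\<in>U. b x * deg x)"
    by (simp add: sum_distrib_left sum.distrib distrib_right)
  also have "\<dots> \<le> 2 * h * R"
    using sum_a_deg_le sum_b_deg_le by (simp add: h_def field_simps)
  finally have D: "D \<le> 5 * X3 + A * B + 2 * h * R"
    unfolding D_def sum_off_diag by simp
  have T: "W + 2 * h + R = 1" using total by (simp add: h_def field_simps)
  note bound = square_bound[OF h R_nn W_pos X1 X2, unfolded T power_one]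
  show "D \<le> 2 / 3" using D bound(1) product_le_sqr by (simp add: h_def)
  assume eq: "D = 2 / 3"
  have AB: "A * B \<le> h\<^sup>2" using product_le_sqr by (simp add: h_def)
  then have "3 * (5 * X3 + h\<^sup>2 + 2 * h * R) = 2 * 1"
    using D eq bound(1) by argo
  from bound(2)[OF this] have *: "R = 0" "h = W" "X3 = h\<^sup>2" by auto
  then have W: "W = 1 / 3" using T by simp
  have X9: "X3 = 1 / 9" using *(3) unfolding *(2) W by (simp add: power2_eq_square)
  have "A + B = 2 / 3" using *(2) W by (simp add: h_def)
  then have "(A + B)\<^sup>2 = 4 / 9" by (simp only:) (simp add: power2_eq_square)
  moreover have "1 / 9 \<le> A * B" using XAB X9 by simp
  moreover have "(A - B)\<^sup>2 = (A + B)\<^sup>2 - 4 * (A * B)" by algebra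
  ultimately have "(A - B)\<^sup>2 \<le> 0" by linarith
  then have AB3: "A = 1 / 3" "B = 1 / 3" using \<open>A + B = 2 / 3\<close> by auto
  \<comment> \<open>All summands are nonnegative because \<open>b x \<le> W = 1/3\<close>, so each
    one vanishes. With the mirror statement for \<open>b\<close>, any vertex with
    \<open>a x \<noteq> 0\<close> has \<open>a x = b x = 1/3\<close>.\<close>
  have "(\<Sum>x\<in>U. a x * (1 / 3 - b x)) = A * (1 / 3) - X3"
    by (simp only: right_diff_distrib sum_subtractf sum_distrib_right)
  also have "\<dots> = 0" using AB3 X9 by simp
  finally have a0: "a x * (1 / 3 - b x) = 0" if "x \<in> U" for x
    using sum_nonneg_eq_0_iff[OF fin, of "\<lambda>x. a x * (1 / 3 - b x)"] that a_nn b_le W by simp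
  have "(\<Sum>x\<in>U. (1 / 3 - a x) * b x) = 1 / 3 * B - X3"
    by (simp only: left_diff_distrib sum_subtractf sum_distrib_left)
  also have "\<dots> = 0" using AB3 X9 by simp
  finally have b0: "(1 / 3 - a x) * b x = 0" if "x \<in> U" for x
    using sum_nonneg_eq_0_iff[OF fin, of "\<lambda>x. (1 / 3 - a x) * b x"] that b_nn a_le W by simp
  obtain x where "x \<in> U" "a x \<noteq> 0"
    using AB3(1) by (metis sum.neutral zero_neq_one divide_eq_0_iff zero_neq_numeral)
  then show "W = 1 / 3 \<and> (\<exists>x\<in>U. a x = 1 / 3 \<and> b x = 1 / 3)"
    using a0[of x] b0[of x] W by auto
qed

text \<open>The numbers \<open>deg y - w x y\<close> and \<open>deg x\<close> measure disjoint sets of edges.\<close>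

lemma two_step_le:
  assumes "x \<in> U"
  shows "(\<Sum>y\<in>U. w x y * (\<Sum>z\<in>U - {x}. w y z)) \<le> deg x * (R - deg x)"
  unfolding sum_distrib_right
proof (intro sum_mono)
  fix y assume y: "y \<in> U"
  show "w x y * (\<Sum>z\<in>U - {x}. w y z) \<le> w x y * (R - deg x)"
  proof (cases "x = y")
    case False
    have "(\<Sum>z\<in>U - {x}. w y z) = deg y - w x y"
      using assms fin sym[of x y] by (simp add: sum_diff1)
    then have "(\<Sum>z\<in>U - {x}. w y z) \<le> R - deg x"
      using deg_pair_le[OF assms y False] by simp
    then show ?thesis using w_nn assms y by (intro mult_left_mono) auto
  qed (simp add: diag)
qed

lemma X4_swap: "X4 = (\<Sum>x\<in>U. \<Sum>y\<in>U. a y * w x y * b x)"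
  by (subst sum.swap) (simp add: sym)

text \<open>Bounding the weight at \<open>v\<close>, or the weight at \<open>u\<close>, by
  \<open>W\<close> leaves a sum of the form \<open>a x * deg x\<close>, or
  \<open>b x * deg x\<close>. The mean of the two bounds depends only on
  \<open>A + B\<close>.\<close>

lemma X4_le: "X4 \<le> W * ((A + B) / 2) * R"
proof -
  have "X4 \<le> (\<Sum>x\<in>U. \<Sum>y\<in>U. a x * w x y * W)"
    using a_nn w_nn b_le by (intro sum_mono mult_left_mono) auto
  also have "\<dots> = W * (\<Sum>x\<in>U. a x * deg x)"
    by (simp add: sum_distrib_left mult_ac)
  also have "\<dots> \<le> W * (A * R)"
    using sum_a_deg_le W_pos by (intro mult_left_mono) auto
  finally have 1: "X4 \<le> W * A * R" by (simp only: mult.assoc)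
  have "X4 \<le> (\<Sum>x\<in>U. \<Sum>y\<in>U. W * w x y * b x)"
    unfolding X4_swap using b_nn w_nn a_le by (intro sum_mono mult_right_mono) auto
  also have "\<dots> = W * (\<Sum>x\<in>U. b x * deg x)"
    by (simp add: sum_distrib_left mult_ac)
  also have "\<dots> \<le> W * (B * R)"
    using sum_b_deg_le W_pos by (intro mult_left_mono) auto
  finally have 2: "X4 \<le> W * B * R" by (simp only: mult.assoc)
  have "W * ((A + B) / 2) * R = (W * A * R + W * B * R) / 2" by algebra
  then show ?thesis using 1 2 by simp
qed

text \<open>Every edge inside \<open>U\<close> other than the heaviest one, \<open>p q\<close>,
  weighs at most \<open>R - w p q\<close>. The second bound gives all pairs that value and charges
  the excess \<open>2 * w p q - R\<close> of \<open>p q\<close> separately, in its two orientations;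
  this is exact on \<open>p q\<close>, whatever the sign of the excess.\<close>

lemma X4_le_max:
  assumes pq: "p \<in> U" "q \<in> U" "p \<noteq> q" and max: "\<And>x y. x \<in> U \<Longrightarrow> y \<in> U \<Longrightarrow> w x y \<le> w p q"
  shows "X4 \<le> w p q * (A * B)"
    and "X4 \<le> (2 * w p q - R) * (a p * b q + a q * b p) + (R - w p q) * (A * B)"
proof -
  have "X4 \<le> (\<Sum>x\<in>U. \<Sum>y\<in>U. w p q * (a x * b y))"
  proof (intro sum_mono)
    fix x y assume "x \<in> U" "y \<in> U"
    then have "w x y * (a x * b y) \<le> w p q * (a x * b y)"
      using a_nn b_nn max by (intro mult_right_mono) auto
    then show "a x * w x y * b y \<le> w p q * (a x * b y)" by (simp add: mult_ac)
  qed
  then show "X4 \<le> w p q * (A * B)"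
    unfolding prod_AB by (simp add: sum_distrib_left)
  let ?m = "2 * w p q - R"
  have "X4 \<le> (\<Sum>x\<in>U. \<Sum>y\<in>U. (R - w p q) * (a x * b y)
      + (if y = q then if x = p then ?m * (a p * b q) else 0 else 0)
      + (if y = p then if x = q then ?m * (a q * b p) else 0 else 0))"
  proof (intro sum_mono)
    fix x y assume xy: "x \<in> U" "y \<in> U"
    have *: "w x y \<le> R - w p q" if ne: "\<not> (x = p \<and> y = q)" "\<not> (x = q \<and> y = p)"
    proof -
      have le: "w x y \<le> deg x" "w x y \<le> deg y"
        using xy fin w_nn member_le_sum[of y U "w x"] member_le_sum[of x U "w y"] sym[of x y] by auto
      consider "x = y" | "x \<notin> {p, q}" | "y \<notin> {p, q}" using \<open>p \<noteq> q\<close> ne by blast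
      then show ?thesis
      proof cases
        case 1
        have "w p q \<le> deg p" using pq fin w_nn by (intro member_le_sum) auto
        then show ?thesis using deg_le[OF pq(1)] 1 diag by simp
      next
        case 2 then show ?thesis using deg_add_le[of x p q] xy pq le by auto
      next
        case 3 then show ?thesis using deg_add_le[of y p q] xy pq le by auto
      qed
    qed
    have "w x y * (a x * b y) \<le> (R - w p q) * (a x * b y)" if "\<not> (x = p \<and> y = q)" "\<not> (x = q \<and> y = p)"
      using *[OF that] a_nn b_nn xy by (intro mult_right_mono) auto
    then show "a x * w x y * b y \<le> (R - w p q) * (a x * b y)
      + (if y = q then if x = p then ?m * (a p * b q) else 0 else 0)
      + (if y = p then if x = q then ?m * (a q * b p) else 0 else 0)"
      using \<open>p \<noteq> q\<close> sym[of p q] by (auto simp: algebra_simps)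
  qed
  also have "\<dots> = ?m * (a p * b q + a q * b p) + (R - w p q) * (A * B)"
    using pq fin by (simp add: sum.distrib prod_AB sum_distrib_left[symmetric] distrib_left)
  finally show "X4 \<le> ?m * (a p * b q + a q * b p) + (R - w p q) * (A * B)" .
qed

text \<open>The analogue of \<open>triangle_bound\<close> for \<open>m = 4\<close>: 4-cycles, paths
  with \<open>u v\<close> as an end edge, paths with \<open>u v\<close> as an inner edge. At
  equality the vertices \<open>x\<close> and \<open>y\<close> complete \<open>u v\<close> to a
  4-cycle of weights 1/4.\<close>

lemma quad_bound:
  defines "D \<equiv> 8 * X4 + (\<Sum>x\<in>U. \<Sum>y\<in>U. \<Sum>z\<in>U - {x}. (a x + b x) * w x y * w y z)
      + (\<Sum>x\<in>U. \<Sum>y\<in>U - {x}. a x * b y * ((\<Sum>z\<in>U - {x}. w y z) + (\<Sum>z\<in>U - {y}. w x z)))"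
  shows "D \<le> 1 / 8"
    and "D = 1 / 8 \<Longrightarrow> W = 1 / 4 \<and> (\<exists>x\<in>U. \<exists>y\<in>U. a x = 1 / 4 \<and> w x y = 1 / 4 \<and> b y = 1 / 4)"
proof -
  define h where "h = (A + B) / 2"
  have h: "0 \<le> h" using A_nn B_nn by (simp add: h_def)
  have T: "W + 2 * h + R = 1" using total by (simp add: h_def field_simps)
  have AB: "A * B \<le> h\<^sup>2" using product_le_sqr by (simp add: h_def)
  have "(\<Sum>x\<in>U. \<Sum>y\<in>U - {x}. a x * b y * ((\<Sum>z\<in>U - {x}. w y z) + (\<Sum>z\<in>U - {y}. w x z)))
      \<le> (\<Sum>x\<in>U. \<Sum>y\<in>U - {x}. R * (a x * b y) - a x * w x y * b y)"
  proof (intro sum_mono)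
    fix x y assume xy: "x \<in> U" "y \<in> U - {x}"
    \<comment> \<open>The excluded choices of \<open>z\<close> are those closing up a 4-cycle and
      save \<open>2 * w x y\<close>. One \<open>w x y\<close> is spent on
      \<open>deg_pair_le\<close>; the other sums to \<open>X4\<close> and lowers the coefficient 8
      to 7.\<close>
    have "(\<Sum>z\<in>U - {x}. w y z) + (\<Sum>z\<in>U - {y}. w x z) = deg y + deg x - 2 * w x y"
      using xy fin sym[of x y] by (simp add: sum_diff1)
    also have "\<dots> \<le> R - w x y"
      using deg_pair_le[of x y] xy by (smt (verit) DiffE insertI1)
    finally have "a x * b y * ((\<Sum>z\<in>U - {x}. w y z) + (\<Sum>z\<in>U - {y}. w x z)) \<le> a x * b y * (R - w x y)"
      using a_nn b_nn xy by (intro mult_left_mono) auto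
    then show "a x * b y * ((\<Sum>z\<in>U - {x}. w y z) + (\<Sum>z\<in>U - {y}. w x z)) \<le> R * (a x * b y) - a x * w x y * b y"
      by (simp add: algebra_simps)
  qed
  also have "\<dots> \<le> (\<Sum>x\<in>U. \<Sum>y\<in>U. R * (a x * b y) - a x * w x y * b y)"
    using a_nn b_nn R_nn diag fin by (intro sum_mono sum_mono2) auto
  also have "\<dots> = R * (A * B) - X4"
    unfolding prod_AB by (simp add: sum_subtractf sum_distrib_left)
  finally have D1: "D \<le> 7 * X4 + A * B * R
      + (\<Sum>x\<in>U. \<Sum>y\<in>U. \<Sum>z\<in>U - {x}. (a x + b x) * w x y * w y z)"
    unfolding D_def mult.commute[of "A * B" R] by linarith
  have two: "(\<Sum>x\<in>U. \<Sum>y\<in>U. \<Sum>z\<in>U - {x}. (a x + b x) * w x y * w y z) \<le> 2 * h * E"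
    if "\<And>x. x \<in> U \<Longrightarrow> deg x * (R - deg x) \<le> E" for E
  proof -
    have "(\<Sum>x\<in>U. \<Sum>y\<in>U. \<Sum>z\<in>U - {x}. (a x + b x) * w x y * w y z)
        = (\<Sum>x\<in>U. (a x + b x) * (\<Sum>y\<in>U. w x y * (\<Sum>z\<in>U - {x}. w y z)))"
      by (simp add: sum_distrib_left mult_ac)
    also have "\<dots> \<le> (\<Sum>x\<in>U. (a x + b x) * E)"
      using two_step_le that a_nn b_nn
      by (intro sum_mono mult_left_mono) (auto intro: order_trans)
    also have "\<dots> = 2 * h * E"
      by (simp add: sum_distrib_right[symmetric] sum.distrib h_def)
    finally show ?thesis .
  qed
  have "D \<le> 1 / 8 \<and> (D = 1 / 8 \<longrightarrow> W = 1 / 4 \<and> (\<exists>x\<in>U. \<exists>y\<in>U. a x = 1 / 4 \<and> w x y = 1 / 4 \<and> b y = 1 / 4))"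
  \<comment> \<open>If there is no weight inside \<open>U\<close>, every term of \<open>D\<close>
    vanishes. Otherwise a heaviest edge \<open>p q\<close> inside \<open>U\<close> exists and has
    distinct ends.\<close>
  proof (cases "\<forall>x\<in>U. \<forall>y\<in>U. w x y = 0")
    case True
    then have "D = 0" by (simp add: D_def)
    then show ?thesis by simp
  next
    case False
    let ?f = "\<lambda>(x, y). w x y"
    have *: "finite (U \<times> U)" "U \<times> U \<noteq> {}" using fin False by auto
    obtain p q where pq: "p \<in> U" "q \<in> U" and Max: "Max (?f ` (U \<times> U)) = w p q"
      using obtains_MAX[OF *, of ?f] by (metis SigmaE case_prod_conv)
    have max: "w x y \<le> w p q" if "x \<in> U" "y \<in> U" for x y
      unfolding Max[symmetric] using that fin by (intro Max_ge) (auto intro!: rev_image_eqI[of "(x, y)"])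
    define M where "M = w p q"
    have "p \<noteq> q"
    proof
      assume "p = q"
      then have "w x y \<le> 0" if "x \<in> U" "y \<in> U" for x y using max[OF that] diag by simp
      then show False using False w_nn by (meson antisym)
    qed
    have "0 \<le> M" using w_nn pq by (simp add: M_def)
    have "M \<le> W" using w_le pq by (simp add: M_def)
    have "M \<le> deg p" "M \<le> deg q"
      using pq fin w_nn member_le_sum[of q U "w p"] member_le_sum[of p U "w q"] sym[of p q]
      by (auto simp: M_def)
    then have "M \<le> R" using deg_le[OF pq(1)] by simp
    \<comment> \<open>\<open>E\<close> bounds \<open>x * (R - x)\<close> over all possible degrees
      \<open>x\<close>. The peak is at \<open>R / 2\<close>, but for \<open>R \<le> 2 * M\<close> no
      degree lies strictly between \<open>R - M\<close> and \<open>M\<close>: the ends of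
      \<open>p q\<close> have degree at least \<open>M\<close>, and any other vertex at most
      \<open>R - M\<close>. The two ends of that gap give the same value.\<close>
    define E where "E = (if R \<le> 2 * M then M * (R - M) else R\<^sup>2 / 4)"
    have sq: "x * (R - x) \<le> R\<^sup>2 / 4" for x :: real
      using sum_squares_ge_zero[of "R / 2 - x" 0] by (simp add: power2_eq_square field_simps)
    have E1: "E \<le> R\<^sup>2 / 4" using sq by (simp add: E_def)
    have E2: "E \<le> M * (R - M)" if "R \<le> 2 * M" using that by (simp add: E_def)
    have E: "deg x * (R - deg x) \<le> E" if "x \<in> U" for x
    proof (cases "R \<le> 2 * M")
      case True
      have "deg x + M \<le> R \<or> M \<le> deg x"
        using \<open>M \<le> deg p\<close> \<open>M \<le> deg q\<close> deg_add_le[OF that pq \<open>p \<noteq> q\<close>] by (auto simp: M_def)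
      then have "0 \<le> (M - deg x) * (R - M - deg x)"
        using True by (auto simp: zero_le_mult_iff)
      also have "\<dots> = M * (R - M) - deg x * (R - deg x)" by (simp add: field_simps)
      finally show ?thesis using True by (simp add: E_def)
    qed (use sq in \<open>simp add: E_def\<close>)
    have D2: "D \<le> 7 * X4 + A * B * R + 2 * h * E" using D1 two[OF E] by linarith
    have X1: "X4 \<le> M * h\<^sup>2"
      using X4_le_max(1)[OF pq \<open>p \<noteq> q\<close> max] mult_left_mono[OF AB \<open>0 \<le> M\<close>] by (simp add: M_def)
    have X2: "X4 \<le> W * h * R" using X4_le by (simp add: h_def)
    have K: "a p * b q + a q * b p \<le> W * h"
    proof -
      have "a p + a q \<le> A" "b p + b q \<le> B"
        using sum_mono2[OF fin, of "{p, q}" a] sum_mono2[OF fin, of "{p, q}" b] pq \<open>p \<noteq> q\<close> a_nn b_nn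
        by simp_all
      moreover have "a p * b q + a q * b p \<le> a p * W + a q * W" "a p * b q + a q * b p \<le> W * b q + W * b p"
        using pq a_nn b_nn a_le b_le by (intro add_mono mult_left_mono mult_right_mono; simp)+
      moreover have "W * (a p + a q) \<le> W * A" "W * (b p + b q) \<le> W * B"
        using calculation(1,2) W_pos by simp_all
      ultimately have "a p * b q + a q * b p \<le> W * A" "a p * b q + a q * b p \<le> W * B"
        by (simp_all add: algebra_simps)
      then show ?thesis by (simp add: h_def field_simps)
    qed
    have X3: "X4 \<le> (2 * M - R) * W * h + (R - M) * h\<^sup>2" if "R \<le> 2 * M"
    proof -
      have "(2 * M - R) * (a p * b q + a q * b p) \<le> (2 * M - R) * (W * h)"
        using K that by (intro mult_left_mono) auto
      moreover have "(R - M) * (A * B) \<le> (R - M) * h\<^sup>2"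
        using AB \<open>M \<le> R\<close> by (intro mult_left_mono) auto
      ultimately show ?thesis
        using X4_le_max(2)[OF pq \<open>p \<noteq> q\<close> max] unfolding M_def mult.assoc[of _ W h] by linarith
    qed
    note bound = cubic_bound[OF \<open>0 \<le> M\<close> \<open>M \<le> W\<close> \<open>M \<le> R\<close> h W_pos E1 E2 X1 X2 X3, unfolded T]
    have ABR: "A * B * R \<le> h\<^sup>2 * R" using AB R_nn by (rule mult_right_mono)
    have "D \<le> 1 / 8" using D2 ABR bound(1) by simp
    moreover have "W = 1 / 4 \<and> (\<exists>x\<in>U. \<exists>y\<in>U. a x = 1 / 4 \<and> w x y = 1 / 4 \<and> b y = 1 / 4)" if "D = 1 / 8"
    proof -
      have "8 * (7 * X4 + h\<^sup>2 * R + 2 * h * E) = 1 ^ 3"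
        using that D2 ABR bound(1) by simp
      then have *: "M = W" "R = W" "h = W" using bound(2) by blast+
      then have W: "W = 1 / 4" using T by simp
      have "E = 0" using * W by (simp add: E_def)
      have "1 / 64 \<le> X4"
        using that D2 ABR * W \<open>E = 0\<close> by (simp add: power2_eq_square)
      \<comment> \<open>Since \<open>w p q = R\<close>, all weight inside \<open>U\<close> sits on
        \<open>p q\<close>: the coefficient \<open>R - w p q\<close> is 0 and the excess is
        1/4.\<close>
      also have "X4 \<le> 1 / 4 * (a p * b q + a q * b p)"
      proof -
        have eqs: "w p q = 1 / 4" "R = 1 / 4" using * W by (auto simp: M_def)
        show ?thesis using X4_le_max(2)[OF pq \<open>p \<noteq> q\<close> max] unfolding eqs by simp
      qed
      finally have ge: "1 / 16 \<le> a p * b q + a q * b p" by simp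
      have le: "a p + a q \<le> A" "b p + b q \<le> B"
        using sum_mono2[OF fin, of "{p, q}" a] sum_mono2[OF fin, of "{p, q}" b] pq \<open>p \<noteq> q\<close> a_nn b_nn
        by simp_all
      have nn: "0 \<le> a p" "0 \<le> a q" "0 \<le> b p" "0 \<le> b q" using pq a_nn b_nn by auto
      have ub: "a p \<le> 1 / 4" "a q \<le> 1 / 4" "b p \<le> 1 / 4" "b q \<le> 1 / 4" using pq a_le b_le W by auto
      \<comment> \<open>The product is at most 1/16, and its cross terms already reach 1/16, so
        \<open>a p * b p\<close> and \<open>a q * b q\<close> vanish. Hence only one orientation of
        the 4-cycle survives, and its two factors, each at most 1/4, must both be 1/4.\<close>
      have "(a p + a q) * (b p + b q) \<le> A * B"
        using le nn A_nn by (intro mult_mono) auto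
      also have "\<dots> \<le> 1 / 16" using AB * W by (simp add: power2_eq_square)
      finally have "a p * b p + a q * b q \<le> 0" using ge by (simp add: algebra_simps)
      then have "a p * b p = 0" "a q * b q = 0"
        using mult_nonneg_nonneg[OF nn(1,3)] mult_nonneg_nonneg[OF nn(2,4)] by linarith+
      have max14: "x = 1 / 4 \<and> y = 1 / 4" if "0 \<le> x" "0 \<le> y" "x \<le> 1 / 4" "y \<le> 1 / 4" "1 / 16 \<le> x * y" for x y :: real
        using mult_left_mono[OF that(4,1)] mult_right_mono[OF that(3,2)] that by linarith
      have wpq: "w p q = 1 / 4" "w q p = 1 / 4" using * W sym[of p q] by (auto simp: M_def)
      show ?thesis
      proof (cases "a p = 0")
        case True
        then have "a q = 1 / 4 \<and> b p = 1 / 4" using max14[of "a q" "b p"] nn ub ge by simp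
        then show ?thesis using W wpq pq by blast
      next
        case False
        then have "b p = 0" using \<open>a p * b p = 0\<close> by simp
        then have "a p = 1 / 4 \<and> b q = 1 / 4" using max14[of "a p" "b q"] nn ub ge by simp
        then show ?thesis using W wpq pq by blast
      qed
    qed
    ultimately show ?thesis by blast
  qed
  then show "D \<le> 1 / 8" "D = 1 / 8 \<Longrightarrow> W = 1 / 4 \<and> (\<exists>x\<in>U. \<exists>y\<in>U. a x = 1 / 4 \<and> w x y = 1 / 4 \<and> b y = 1 / 4)"
    by blast+
qed

end

section \<open>Copies of short cycles and paths\<close>

lemma cycle3_iff:
  "is_cycle_copy V 3 S \<longleftrightarrow> (\<exists>x y z. distinct [x, y, z] \<and> {x, y, z} \<subseteq> V \<and> S = {{x, y}, {y, z}, {z, x}})"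
  (is "_ \<longleftrightarrow> ?R")
proof
  have 3: "{0..<3} = {0, 1, 2::nat}" by auto
  show ?R if cyc: "is_cycle_copy V 3 S"
  proof -
    obtain f :: "nat \<Rightarrow> _" where f: "inj_on f {0..<3}" "f ` {0..<3} \<subseteq> V"
      and S: "S = (\<lambda>i. {f i, f ((i + 1) mod 3)}) ` {0..<3}"
      using cyc unfolding is_cycle_copy_def by blast
    have "distinct [f 0, f 1, f 2]" using f(1) unfolding 3 by (auto simp: inj_on_def)
    moreover have "{f 0, f 1, f 2} \<subseteq> V" using f(2) unfolding 3 by auto
    moreover have "S = {{f 0, f 1}, {f 1, f 2}, {f 2, f 0}}" unfolding S 3 by (simp add: numeral_2_eq_2)
    ultimately show ?thesis by blast
  qed
  assume ?R
  then obtain x y z where xyz: "distinct [x, y, z]" "{x, y, z} \<subseteq> V" "S = {{x, y}, {y, z}, {z, x}}"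
    by blast
  then have "distinct [z, y, x]" by auto
  let ?f = "\<lambda>i::nat. if i = 0 then x else if i = 1 then y else z"
  have "inj_on ?f {0..<3}" "?f ` {0..<3} \<subseteq> V" "S = (\<lambda>i. {?f i, ?f ((i + 1) mod 3)}) ` {0..<3}"
    using xyz \<open>distinct [z, y, x]\<close> unfolding 3 by (simp_all add: inj_on_def)
  then show "is_cycle_copy V 3 S" unfolding is_cycle_copy_def by blast
qed

lemma cycle4_iff:
  "is_cycle_copy V 4 S \<longleftrightarrow>
    (\<exists>x y z t. distinct [x, y, z, t] \<and> {x, y, z, t} \<subseteq> V \<and> S = {{x, y}, {y, z}, {z, t}, {t, x}})"
  (is "_ \<longleftrightarrow> ?R")
proof
  have 4: "{0..<4} = {0, 1, 2, 3::nat}" by auto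
  show ?R if cyc: "is_cycle_copy V 4 S"
  proof -
    obtain f :: "nat \<Rightarrow> _" where f: "inj_on f {0..<4}" "f ` {0..<4} \<subseteq> V"
      and S: "S = (\<lambda>i. {f i, f ((i + 1) mod 4)}) ` {0..<4}"
      using cyc unfolding is_cycle_copy_def by blast
    have "distinct [f 0, f 1, f 2, f 3]" using f(1) unfolding 4 by (auto simp: inj_on_def)
    moreover have "{f 0, f 1, f 2, f 3} \<subseteq> V" using f(2) unfolding 4 by auto
    moreover have "S = {{f 0, f 1}, {f 1, f 2}, {f 2, f 3}, {f 3, f 0}}"
      unfolding S 4 by (simp flip: numeral_2_eq_2)
    ultimately show ?thesis by blast
  qed
  assume ?R
  then obtain x y z t where xyz: "distinct [x, y, z, t]" "{x, y, z, t} \<subseteq> V"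
    "S = {{x, y}, {y, z}, {z, t}, {t, x}}"
    by blast
  then have "distinct [t, z, y, x]" by auto
  let ?f = "\<lambda>i::nat. if i = 0 then x else if i = 1 then y else if i = 2 then z else t"
  have "inj_on ?f {0..<4}" "?f ` {0..<4} \<subseteq> V" "S = (\<lambda>i. {?f i, ?f ((i + 1) mod 4)}) ` {0..<4}"
    using xyz \<open>distinct [t, z, y, x]\<close> unfolding 4 by (simp_all add: inj_on_def)
  then show "is_cycle_copy V 4 S" unfolding is_cycle_copy_def by blast
qed

lemma path4E:
  assumes "is_path_copy V 4 S"
  obtains x y z t where "distinct [x, y, z, t]" "{x, y, z, t} \<subseteq> V" "S = {{x, y}, {y, z}, {z, t}}"
proof -
  have 3: "{0..<4 - 1} = {0, 1, 2::nat}" and 4: "{0..<4} = {0, 1, 2, 3::nat}" by auto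
  obtain f :: "nat \<Rightarrow> _" where f: "inj_on f {0..<4}" "f ` {0..<4} \<subseteq> V"
    and S: "S = (\<lambda>i. {f i, f (i + 1)}) ` {0..<4 - 1}"
    using assms unfolding is_path_copy_def by blast
  have "distinct [f 0, f 1, f 2, f 3]" using f(1) unfolding 4 by (auto simp: inj_on_def)
  moreover have "{f 0, f 1, f 2, f 3} \<subseteq> V" using f(2) unfolding 4 by auto
  moreover have "S = {{f 0, f 1}, {f 1, f 2}, {f 2, f 3}}"
    unfolding S 3 by (simp add: eval_nat_numeral)
  ultimately show ?thesis using that by blast
qed

lemma path5E:
  assumes "is_path_copy V 5 S"
  obtains x y z t s where "distinct [x, y, z, t, s]" "{x, y, z, t, s} \<subseteq> V"
    "S = {{x, y}, {y, z}, {z, t}, {t, s}}"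
proof -
  have 4: "{0..<5 - 1} = {0, 1, 2, 3::nat}" and 5: "{0..<5} = {0, 1, 2, 3, 4::nat}" by auto
  obtain f :: "nat \<Rightarrow> _" where f: "inj_on f {0..<5}" "f ` {0..<5} \<subseteq> V"
    and S: "S = (\<lambda>i. {f i, f (i + 1)}) ` {0..<5 - 1}"
    using assms unfolding is_path_copy_def by blast
  have "distinct [f 0, f 1, f 2, f 3, f 4]" using f(1) unfolding 5 by (auto simp: inj_on_def)
  moreover have "{f 0, f 1, f 2, f 3, f 4} \<subseteq> V" using f(2) unfolding 5 by auto
  moreover have "S = {{f 0, f 1}, {f 1, f 2}, {f 2, f 3}, {f 3, f 4}}"
    unfolding S 4 by (simp add: eval_nat_numeral)
  ultimately show ?thesis using that by blast
qed

lemma cycle3_through: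
  assumes "is_cycle_copy V 3 S" "{u, v} \<in> S"
  shows "\<exists>x\<in>V. distinct [u, v, x] \<and> S = {{u, v}, {u, x}, {v, x}}"
proof -
  obtain x y z where *: "distinct [x, y, z]" "{x, y, z} \<subseteq> V" "S = {{x, y}, {y, z}, {z, x}}"
    using assms(1) unfolding cycle3_iff by blast
  have rev: "distinct [z, y, x]" using *(1) by auto
  from assms(2) *(3) consider "u = x \<and> v = y \<or> u = y \<and> v = x"
    | "u = y \<and> v = z \<or> u = z \<and> v = y" | "u = z \<and> v = x \<or> u = x \<and> v = z"
    by (auto simp: doubleton_eq_iff)
  then show ?thesis
  proof cases
    case 1 then show ?thesis using * rev by ((elim disjE conjE)?; intro bexI[of _ z]; simp add: insert_commute)
  next
    case 2 then show ?thesis using * rev by ((elim disjE conjE)?; intro bexI[of _ x]; simp add: insert_commute)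
  next
    case 3 then show ?thesis using * rev by ((elim disjE conjE)?; intro bexI[of _ y]; simp add: insert_commute)
  qed
qed

lemma cycle4_through:
  assumes "is_cycle_copy V 4 S" "{u, v} \<in> S"
  shows "\<exists>x y. {x, y} \<subseteq> V \<and> distinct [u, v, x, y] \<and> S = {{u, v}, {u, x}, {x, y}, {v, y}}"
proof -
  obtain x y z t where *: "distinct [x, y, z, t]" "{x, y, z, t} \<subseteq> V"
    "S = {{x, y}, {y, z}, {z, t}, {t, x}}"
    using assms(1) unfolding cycle4_iff by blast
  have rev: "distinct [t, z, y, x]" using *(1) by auto
  from assms(2) *(3) consider "u = x" "v = y" | "u = y" "v = x" | "u = y" "v = z" | "u = z" "v = y"
    | "u = z" "v = t" | "u = t" "v = z" | "u = t" "v = x" | "u = x" "v = t"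
    by (auto simp: doubleton_eq_iff)
  then show ?thesis
  proof cases
    case 1 then show ?thesis using * rev by ((elim disjE conjE)?; intro exI[of _ t] exI[of _ z]; simp add: insert_commute)
  next
    case 2 then show ?thesis using * rev by ((elim disjE conjE)?; intro exI[of _ z] exI[of _ t]; simp add: insert_commute)
  next
    case 3 then show ?thesis using * rev by ((elim disjE conjE)?; intro exI[of _ x] exI[of _ t]; simp add: insert_commute)
  next
    case 4 then show ?thesis using * rev by ((elim disjE conjE)?; intro exI[of _ t] exI[of _ x]; simp add: insert_commute)
  next
    case 5 then show ?thesis using * rev by ((elim disjE conjE)?; intro exI[of _ y] exI[of _ x]; simp add: insert_commute)
  next
    case 6 then show ?thesis using * rev by ((elim disjE conjE)?; intro exI[of _ x] exI[of _ y]; simp add: insert_commute)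
  next
    case 7 then show ?thesis using * rev by ((elim disjE conjE)?; intro exI[of _ z] exI[of _ y]; simp add: insert_commute)
  next
    case 8 then show ?thesis using * rev by ((elim disjE conjE)?; intro exI[of _ y] exI[of _ z]; simp add: insert_commute)
  qed
qed

text \<open>The shapes say where \<open>u v\<close> lies: in the middle, or at an end with
  \<open>v\<close>, respectively \<open>u\<close>, as the end vertex.\<close>

lemma path4_through:
  assumes "is_path_copy V 4 S" "{u, v} \<in> S"
  shows "\<exists>x y. {x, y} \<subseteq> V \<and> distinct [u, v, x, y] \<and>
    (S = {{u, v}, {u, x}, {v, y}} \<or> S = {{u, v}, {u, x}, {x, y}} \<or> S = {{u, v}, {v, x}, {x, y}})"
proof -
  obtain x y z t where *: "distinct [x, y, z, t]" "{x, y, z, t} \<subseteq> V" "S = {{x, y}, {y, z}, {z, t}}"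
    using path4E[OF assms(1)] by metis
  have rev: "distinct [t, z, y, x]" using *(1) by auto
  from assms(2) *(3) consider "u = x \<and> v = y \<or> u = y \<and> v = x" | "u = y" "v = z" | "u = z" "v = y"
    | "u = z \<and> v = t \<or> u = t \<and> v = z"
    by (auto simp: doubleton_eq_iff)
  then show ?thesis
  proof cases
    case 1 then show ?thesis using * rev by ((elim disjE conjE)?; intro exI[of _ z] exI[of _ t]; simp add: insert_commute)
  next
    case 2 then show ?thesis using * rev by ((elim disjE conjE)?; intro exI[of _ x] exI[of _ t]; simp add: insert_commute)
  next
    case 3 then show ?thesis using * rev by ((elim disjE conjE)?; intro exI[of _ t] exI[of _ x]; simp add: insert_commute)
  next
    case 4 then show ?thesis using * rev by ((elim disjE conjE)?; intro exI[of _ y] exI[of _ x]; simp add: insert_commute)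
  qed
qed

text \<open>In the first two shapes \<open>u v\<close> is an end edge, with \<open>v\<close>,
  respectively \<open>u\<close>, as the end vertex. In the last two it is an inner edge, with the
  longer arm at \<open>v\<close>, respectively \<open>u\<close>.\<close>

lemma path5_through:
  assumes "is_path_copy V 5 S" "{u, v} \<in> S"
  shows "\<exists>x y z. {x, y, z} \<subseteq> V \<and> distinct [u, v, x, y, z] \<and>
    (S = {{u, v}, {u, x}, {x, y}, {y, z}} \<or> S = {{u, v}, {v, x}, {x, y}, {y, z}} \<or>
     S = {{u, v}, {u, x}, {v, y}, {y, z}} \<or> S = {{u, v}, {u, x}, {v, y}, {x, z}})"
proof -
  obtain x y z t s where *: "distinct [x, y, z, t, s]" "{x, y, z, t, s} \<subseteq> V"
    "S = {{x, y}, {y, z}, {z, t}, {t, s}}"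
    using path5E[OF assms(1)] by metis
  have rev: "distinct [s, t, z, y, x]" using *(1) by auto
  from assms(2) *(3) consider "u = x \<and> v = y \<or> u = y \<and> v = x" | "u = y" "v = z" | "u = z" "v = y"
    | "u = z" "v = t" | "u = t" "v = z" | "u = t \<and> v = s \<or> u = s \<and> v = t"
    by (auto simp: doubleton_eq_iff)
  then show ?thesis
  proof cases
    case 1 then show ?thesis using * rev by ((elim disjE conjE)?; intro exI[of _ z] exI[of _ t] exI[of _ s]; simp add: insert_commute)
  next
    case 2 then show ?thesis using * rev by ((elim disjE conjE)?; intro exI[of _ x] exI[of _ t] exI[of _ s]; simp add: insert_commute)
  next
    case 3 then show ?thesis using * rev by ((elim disjE conjE)?; intro exI[of _ t] exI[of _ x] exI[of _ s]; simp add: insert_commute)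
  next
    case 4 then show ?thesis using * rev by ((elim disjE conjE)?; intro exI[of _ y] exI[of _ s] exI[of _ x]; simp add: insert_commute)
  next
    case 5 then show ?thesis using * rev by ((elim disjE conjE)?; intro exI[of _ s] exI[of _ y] exI[of _ x]; simp add: insert_commute)
  next
    case 6 then show ?thesis using * rev by ((elim disjE conjE)?; intro exI[of _ z] exI[of _ y] exI[of _ x]; simp add: insert_commute)
  qed
qed

section \<open>Sums over edges and over families of copies\<close>

lemma finite_Kedges: "finite V \<Longrightarrow> finite (Kedges V)"
  by (rule finite_subset[of _ "Pow V"]) (auto simp: Kedges_def)

lemma doubleton_in_Kedges: "{x, y} \<in> Kedges V \<longleftrightarrow> x \<in> V \<and> y \<in> V \<and> x \<noteq> y"
  by (auto simp: Kedges_def doubleton_eq_iff)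

lemma Kedges_insert: "v \<notin> V \<Longrightarrow> Kedges (insert v V) = Kedges V \<union> (\<lambda>x. {v, x}) ` V"
  unfolding Kedges_def by (auto simp: insert_commute)

lemma sum_Kedges_insert:
  fixes \<nu> :: "'a set \<Rightarrow> real"
  assumes "finite V" "v \<notin> V"
  shows "sum \<nu> (Kedges (insert v V)) = sum \<nu> (Kedges V) + (\<Sum>x\<in>V. \<nu> {v, x})"
proof -
  have "inj_on (\<lambda>x. {v, x}) V" by (auto simp: inj_on_def doubleton_eq_iff)
  moreover have "Kedges V \<inter> (\<lambda>x. {v, x}) ` V = {}" using assms(2) by (auto simp: Kedges_def doubleton_eq_iff)
  ultimately show ?thesis
    using assms by (simp add: Kedges_insert sum.union_disjoint finite_Kedges sum.reindex)
qed

lemma sum_Kedges_double: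
  fixes \<nu> :: "'a set \<Rightarrow> real"
  assumes "finite V"
  shows "(\<Sum>x\<in>V. \<Sum>y\<in>V. if x = y then 0 else \<nu> {x, y}) = 2 * sum \<nu> (Kedges V)"
  using assms
proof (induction V)
  case empty
  then show ?case by (simp add: Kedges_def)
next
  case (insert v V)
  have "(\<Sum>x\<in>V. if v = x then 0 else \<nu> {v, x}) = (\<Sum>x\<in>V. \<nu> {v, x})"
    "(\<Sum>x\<in>V. if x = v then 0 else \<nu> {x, v}) = (\<Sum>x\<in>V. \<nu> {v, x})"
    using insert.hyps by (auto intro!: sum.cong simp: insert_commute)
  with insert show ?case
    by (simp add: sum_Kedges_insert sum.distrib)
qed

lemma sum_Sigma3:
  assumes "finite A" "\<And>x. finite (B x)" "\<And>x y. finite (C x y)"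
  shows "(\<Sum>(x, y, z)\<in>(SIGMA x:A. SIGMA y:B x. C x y). f x y z) = (\<Sum>x\<in>A. \<Sum>y\<in>B x. \<Sum>z\<in>C x y. f x y z)"
  using assms by (simp add: sum.Sigma)

text \<open>Only surjectivity of the parametrisation \<open>g\<close> matters. A copy that arises
  from several indices merely enlarges the right-hand side, so no canonical labelling of copies has
  to be chosen.\<close>

lemma sum_le_family:
  fixes h :: "'s \<Rightarrow> real" and k :: "'i \<Rightarrow> real"
  assumes "finite Q" "finite I" "\<And>i. i \<in> I \<Longrightarrow> 0 \<le> k i"
    and "\<And>S. S \<in> Q \<Longrightarrow> P S \<Longrightarrow> \<exists>i\<in>I. g i = S \<and> h S \<le> k i"
  shows "sum h {S \<in> Q. P S} \<le> sum k I"
  using assms by (intro sum_le_included[where i = g]) auto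

text \<open>A union bound: the shapes may overlap, and counting a copy twice is harmless for an
  upper bound.\<close>

lemma sum_le_disj4:
  fixes h :: "'s \<Rightarrow> real"
  assumes "finite Q" "\<And>S. S \<in> Q \<Longrightarrow> 0 \<le> h S"
    and "\<And>S. S \<in> Q \<Longrightarrow> P1 S \<or> P2 S \<or> P3 S \<or> P4 S"
  shows "sum h Q \<le> sum h {S \<in> Q. P1 S} + sum h {S \<in> Q. P2 S} + sum h {S \<in> Q. P3 S} + sum h {S \<in> Q. P4 S}"
proof -
  have "sum h Q \<le> (\<Sum>S\<in>Q. (if P1 S then h S else 0) + (if P2 S then h S else 0)
      + (if P3 S then h S else 0) + (if P4 S then h S else 0))"
    using assms(2,3) by (intro sum_mono) fastforce
  then show ?thesis using assms(1) by (simp add: sum.distrib sum.inter_filter)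
qed

section \<open>The left-hand side as a multi-affine form\<close>

definition copy_coeff :: "'a set \<Rightarrow> nat \<Rightarrow> 'a set set \<Rightarrow> real" where
  "copy_coeff V m S = 2 * real m * of_bool (is_cycle_copy V m S) + of_bool (is_path_copy V (m + 1) S)"

lemma beta_eq:
  assumes "finite V"
  shows "2 * real m * beta V \<nu> (is_cycle_copy V m) + beta V \<nu> (is_path_copy V (m + 1))
    = multilin (Kedges V) (copy_coeff V m) \<nu>"
proof -
  have "beta V \<nu> P = (\<Sum>S\<in>Pow (Kedges V). of_bool (P S) * prod \<nu> S)" for P
  proof -
    have "{S. S \<subseteq> Kedges V \<and> P S} = {S \<in> Pow (Kedges V). P S}" by auto
    then show ?thesis
      using finite_Kedges[OF assms] unfolding beta_def
      by (simp only: sum.inter_filter finite_Pow_iff) (intro sum.cong; simp)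
  qed
  then show ?thesis
    by (simp add: multilin_def copy_coeff_def sum_distrib_left sum.distrib algebra_simps)
qed

lemma multilin_cong: "(\<And>e. e \<in> E \<Longrightarrow> \<mu> e = \<nu> e) \<Longrightarrow> multilin E c \<mu> = multilin E c \<nu>"
  unfolding multilin_def by (intro sum.cong refl arg_cong2[where f = "(*)"] prod.cong) auto

lemma copy_coeff_homogeneous:
  assumes "m \<in> {3, 4}" "copy_coeff V m S \<noteq> 0"
  shows "card S = m"
proof -
  have "is_cycle_copy V m S \<or> is_path_copy V (m + 1) S"
    using assms(2) by (auto simp: copy_coeff_def)
  then show ?thesis
  proof
    assume "is_cycle_copy V m S"
    with assms(1) show ?thesis
      by (auto simp: cycle3_iff cycle4_iff card_insert_if doubleton_eq_iff)
  next
    assume "is_path_copy V (m + 1) S"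
    with assms(1) show ?thesis
      by (auto elim!: path4E path5E simp: card_insert_if doubleton_eq_iff)
  qed
qed

lemma copy_deriv_eq:
  assumes "finite V"
  shows "multilin_deriv (Kedges V) (copy_coeff V m) e \<nu>
    = 2 * real m * (\<Sum>S | S \<subseteq> Kedges V \<and> is_cycle_copy V m S \<and> e \<in> S. prod \<nu> (S - {e}))
      + (\<Sum>S | S \<subseteq> Kedges V \<and> is_path_copy V (m + 1) S \<and> e \<in> S. prod \<nu> (S - {e}))"
proof -
  have "(\<Sum>S | S \<subseteq> Kedges V \<and> P S \<and> e \<in> S. prod \<nu> (S - {e}))
    = (\<Sum>S\<in>Pow (Kedges V). if e \<in> S then of_bool (P S) * prod \<nu> (S - {e}) else 0)" for P
  proof -
    have "{S. S \<subseteq> Kedges V \<and> P S \<and> e \<in> S} = {S \<in> Pow (Kedges V). P S \<and> e \<in> S}" by auto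
    then show ?thesis
      using finite_Kedges[OF assms]
      by (simp only: sum.inter_filter finite_Pow_iff) (intro sum.cong; simp)
  qed
  then show ?thesis
    by (simp add: multilin_deriv_def copy_coeff_def sum_distrib_left sum.distrib[symmetric])
      (intro sum.cong; simp add: copy_coeff_def algebra_simps)
qed

section \<open>The derivative at a heaviest edge\<close>

locale heaviest_edge =
  fixes V :: "'a set" and \<nu> :: "'a set \<Rightarrow> real" and u v :: 'a
  assumes fin_V: "finite V" and \<nu>: "\<nu> \<in> prob_weights (Kedges V)"
    and uv: "u \<in> V" "v \<in> V" "u \<noteq> v"
    and max: "\<And>f. f \<in> Kedges V \<Longrightarrow> \<nu> f \<le> \<nu> {u, v}"
begin

abbreviation "U \<equiv> V - {u, v}"
text \<open>\<open>{x, x}\<close> is a singleton and not an edge, hence the zero diagonal.\<close>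

abbreviation "w x y \<equiv> if x = y then 0 else \<nu> {x, y}"
abbreviation "a x \<equiv> \<nu> {u, x}"
abbreviation "b x \<equiv> \<nu> {v, x}"

lemma \<nu>_nn: "0 \<le> \<nu> f"
  using \<nu> unfolding prob_weights_def by (cases "f \<in> Kedges V") auto

lemma prod_nn: "0 \<le> prod \<nu> S"
  by (simp add: prod_nonneg \<nu>_nn)

lemma max_pos: "0 < \<nu> {u, v}"
proof (rule ccontr)
  assume "\<not> ?thesis"
  then have "\<nu> f = 0" if "f \<in> Kedges V" for f
    using max[OF that] \<nu>_nn[of f] by simp
  then show False using \<nu> by (simp add: prob_weights_def)
qed

lemma V_eq: "V = insert u (insert v U)"
  using uv by auto

lemma sum_edges: "sum \<nu> (Kedges V) = \<nu> {u, v} + sum a U + sum b U + (\<Sum>x\<in>U. \<Sum>y\<in>U. w x y) / 2"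
proof -
  have "sum \<nu> (Kedges (insert u (insert v U)))
      = \<nu> {u, v} + sum a U + sum b U + sum \<nu> (Kedges U)"
    using fin_V uv by (subst sum_Kedges_insert; simp add: sum_Kedges_insert)
  then show ?thesis
    using sum_Kedges_double[of U \<nu>] fin_V by (simp flip: V_eq)
qed

sublocale heavy_edge U w a b "\<nu> {u, v}"
proof
  show "\<nu> {u, v} + sum a U + sum b U + (\<Sum>x\<in>U. \<Sum>y\<in>U. w x y) / 2 = 1"
    using \<nu> sum_edges by (simp add: prob_weights_def)
qed (use fin_V uv \<nu>_nn max max_pos in \<open>auto simp: insert_commute doubleton_in_Kedges less_imp_le\<close>)

lemma prod_remove2:
  assumes "distinct [e, p, q]"
  shows "prod \<nu> ({e, p, q} - {e}) = \<nu> p * \<nu> q"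
proof -
  have "{e, p, q} - {e} = {p, q}" using assms by auto
  then show ?thesis using assms by simp
qed

lemma prod_remove3:
  assumes "distinct [e, p, q, r]"
  shows "prod \<nu> ({e, p, q, r} - {e}) = \<nu> p * \<nu> q * \<nu> r"
proof -
  have "{e, p, q, r} - {e} = {p, q, r}" using assms by auto
  then show ?thesis using assms by simp
qed

lemma finite_families: "finite {S. S \<subseteq> Kedges V \<and> P S}"
  using finite_Kedges[OF fin_V] by simp

abbreviation "h S \<equiv> prod \<nu> (S - {{u, v}})"

lemma cycle3_sum_le:
  "(\<Sum>S | S \<subseteq> Kedges V \<and> is_cycle_copy V 3 S \<and> {u, v} \<in> S. h S) \<le> X3" (is "sum h ?Q \<le> _")
proof (rule sum_le_included[where i = "\<lambda>x. {{u, v}, {u, x}, {v, x}}"])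
  show "\<forall>S\<in>?Q. \<exists>x\<in>U. {{u, v}, {u, x}, {v, x}} = S \<and> h S \<le> a x * b x"
  proof
    fix S assume "S \<in> ?Q"
    then obtain x where x: "x \<in> V" "distinct [u, v, x]" and S: "S = {{u, v}, {u, x}, {v, x}}"
      using cycle3_through[of V S u v] by blast
    have hS: "h S = a x * b x"
      unfolding S using x by (intro prod_remove2) (auto simp: doubleton_eq_iff)
    show "\<exists>x\<in>U. {{u, v}, {u, x}, {v, x}} = S \<and> h S \<le> a x * b x"
      using x by (intro bexI[of _ x]) (auto simp: hS S[symmetric])
  qed
qed (use fin finite_families \<nu>_nn in auto)

lemma cycle4_sum_le:
  "(\<Sum>S | S \<subseteq> Kedges V \<and> is_cycle_copy V 4 S \<and> {u, v} \<in> S. h S) \<le> X4" (is "sum h ?Q \<le> _")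
proof -
  let ?g = "\<lambda>(x, y). {{u, v}, {u, x}, {x, y}, {v, y}}" and ?k = "\<lambda>(x, y). a x * w x y * b y"
  have "sum h ?Q \<le> sum ?k (U \<times> U)"
  proof (rule sum_le_included[where i = ?g])
    show "\<forall>S\<in>?Q. \<exists>p\<in>U \<times> U. ?g p = S \<and> h S \<le> ?k p"
    proof
      fix S assume "S \<in> ?Q"
      then obtain x y where x: "{x, y} \<subseteq> V" "distinct [u, v, x, y]"
        and S: "S = {{u, v}, {u, x}, {x, y}, {v, y}}"
        using cycle4_through[of V S u v] by blast
      have hS: "h S = a x * \<nu> {x, y} * b y"
        unfolding S using x by (intro prod_remove3) (auto simp: doubleton_eq_iff)
      show "\<exists>p\<in>U \<times> U. ?g p = S \<and> h S \<le> ?k p"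
        using x by (intro bexI[of _ "(x, y)"]) (auto simp: hS S[symmetric])
    qed
  qed (use fin finite_families \<nu>_nn in auto)
  then show ?thesis by (simp only: sum.cartesian_product)
qed

lemma path4_sum_le:
  "(\<Sum>S | S \<subseteq> Kedges V \<and> is_path_copy V 4 S \<and> {u, v} \<in> S. h S)
    \<le> (\<Sum>x\<in>U. \<Sum>y\<in>U - {x}. a x * b y) + (\<Sum>x\<in>U. \<Sum>y\<in>U. (a x + b x) * w x y)"
  (is "sum h ?Q \<le> _")
proof -
  define P1 where "P1 S \<longleftrightarrow> (\<exists>x y. {x, y} \<subseteq> V \<and> distinct [u, v, x, y] \<and> S = {{u, v}, {u, x}, {v, y}})" for S
  define P2 where "P2 S \<longleftrightarrow> (\<exists>x y. {x, y} \<subseteq> V \<and> distinct [u, v, x, y] \<and> S = {{u, v}, {u, x}, {x, y}})" for S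
  define P3 where "P3 S \<longleftrightarrow> (\<exists>x y. {x, y} \<subseteq> V \<and> distinct [u, v, x, y] \<and> S = {{u, v}, {v, x}, {x, y}})" for S
  have "sum h ?Q \<le> sum h {S \<in> ?Q. P1 S} + sum h {S \<in> ?Q. P2 S} + sum h {S \<in> ?Q. P3 S} + sum h {S \<in> ?Q. False}"
  proof (rule sum_le_disj4)
    fix S assume "S \<in> ?Q"
    then have "is_path_copy V 4 S" "{u, v} \<in> S" by auto
    from path4_through[OF this] show "P1 S \<or> P2 S \<or> P3 S \<or> False"
      unfolding P1_def P2_def P3_def by (elim exE conjE disjE; metis)
  qed (use finite_families prod_nn in auto)
  also have "sum h {S \<in> ?Q. P1 S} \<le> (\<Sum>(x, y)\<in>(SIGMA x:U. U - {x}). a x * b y)"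
  proof (rule sum_le_family[where g = "\<lambda>(x, y). {{u, v}, {u, x}, {v, y}}"])
    fix S assume "P1 S"
    then obtain x y where x: "{x, y} \<subseteq> V" "distinct [u, v, x, y]" and S: "S = {{u, v}, {u, x}, {v, y}}"
      unfolding P1_def by blast
    have hS: "h S = a x * b y"
      unfolding S using x by (intro prod_remove2) (auto simp: doubleton_eq_iff)
    show "\<exists>i\<in>(SIGMA x:U. U - {x}). (case i of (x, y) \<Rightarrow> {{u, v}, {u, x}, {v, y}}) = S
        \<and> h S \<le> (case i of (x, y) \<Rightarrow> a x * b y)"
      using x by (intro bexI[of _ "(x, y)"]) (auto simp: hS S[symmetric])
  qed (use fin finite_families \<nu>_nn in auto)
  also have "sum h {S \<in> ?Q. P2 S} \<le> (\<Sum>(x, y)\<in>U \<times> U. a x * w x y)"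
  proof (rule sum_le_family[where g = "\<lambda>(x, y). {{u, v}, {u, x}, {x, y}}"])
    fix S assume "P2 S"
    then obtain x y where x: "{x, y} \<subseteq> V" "distinct [u, v, x, y]" and S: "S = {{u, v}, {u, x}, {x, y}}"
      unfolding P2_def by blast
    have hS: "h S = a x * \<nu> {x, y}"
      unfolding S using x by (intro prod_remove2) (auto simp: doubleton_eq_iff)
    show "\<exists>i\<in>U \<times> U. (case i of (x, y) \<Rightarrow> {{u, v}, {u, x}, {x, y}}) = S
        \<and> h S \<le> (case i of (x, y) \<Rightarrow> a x * w x y)"
      using x by (intro bexI[of _ "(x, y)"]) (auto simp: hS S[symmetric])
  qed (use fin finite_families \<nu>_nn in auto)
  also have "sum h {S \<in> ?Q. P3 S} \<le> (\<Sum>(x, y)\<in>U \<times> U. b x * w x y)"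
  proof (rule sum_le_family[where g = "\<lambda>(x, y). {{u, v}, {v, x}, {x, y}}"])
    fix S assume "P3 S"
    then obtain x y where x: "{x, y} \<subseteq> V" "distinct [u, v, x, y]" and S: "S = {{u, v}, {v, x}, {x, y}}"
      unfolding P3_def by blast
    have hS: "h S = b x * \<nu> {x, y}"
      unfolding S using x by (intro prod_remove2) (auto simp: doubleton_eq_iff)
    show "\<exists>i\<in>U \<times> U. (case i of (x, y) \<Rightarrow> {{u, v}, {v, x}, {x, y}}) = S
        \<and> h S \<le> (case i of (x, y) \<Rightarrow> b x * w x y)"
      using x by (intro bexI[of _ "(x, y)"]) (auto simp: hS S[symmetric])
  qed (use fin finite_families \<nu>_nn in auto)
  finally have "sum h ?Q \<le> (\<Sum>x\<in>U. \<Sum>y\<in>U - {x}. a x * b y) + (\<Sum>x\<in>U. \<Sum>y\<in>U. a x * w x y)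
      + (\<Sum>x\<in>U. \<Sum>y\<in>U. b x * w x y)"
    using fin by (simp only: sum.Sigma sum.cartesian_product simp_thms finite_Diff ball_triv) simp
  then show ?thesis by (simp only: distrib_right sum.distrib add.assoc)
qed

text \<open>The index sets spell out only the inequalities that the zero diagonal of
  \<open>w\<close> does not enforce. Consecutive vertices inside \<open>U\<close> differ or the term
  is 0, so what remains is \<open>z \<noteq> x\<close> or \<open>z \<noteq> y\<close>, and
  \<open>y \<noteq> x\<close> when \<open>x\<close> and \<open>y\<close> hang on different ends of
  \<open>u v\<close>.\<close>

lemma path5_sum_le:
  "(\<Sum>S | S \<subseteq> Kedges V \<and> is_path_copy V 5 S \<and> {u, v} \<in> S. h S)
    \<le> (\<Sum>x\<in>U. \<Sum>y\<in>U. \<Sum>z\<in>U - {x}. (a x + b x) * w x y * w y z)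
      + (\<Sum>x\<in>U. \<Sum>y\<in>U - {x}. a x * b y * ((\<Sum>z\<in>U - {x}. w y z) + (\<Sum>z\<in>U - {y}. w x z)))"
  (is "sum h ?Q \<le> _")
proof -
  define P1 where "P1 S \<longleftrightarrow> (\<exists>x y z. {x, y, z} \<subseteq> V \<and> distinct [u, v, x, y, z] \<and> S = {{u, v}, {u, x}, {x, y}, {y, z}})" for S
  define P2 where "P2 S \<longleftrightarrow> (\<exists>x y z. {x, y, z} \<subseteq> V \<and> distinct [u, v, x, y, z] \<and> S = {{u, v}, {v, x}, {x, y}, {y, z}})" for S
  define P3 where "P3 S \<longleftrightarrow> (\<exists>x y z. {x, y, z} \<subseteq> V \<and> distinct [u, v, x, y, z] \<and> S = {{u, v}, {u, x}, {v, y}, {y, z}})" for S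
  define P4 where "P4 S \<longleftrightarrow> (\<exists>x y z. {x, y, z} \<subseteq> V \<and> distinct [u, v, x, y, z] \<and> S = {{u, v}, {u, x}, {v, y}, {x, z}})" for S
  have "sum h ?Q \<le> sum h {S \<in> ?Q. P1 S} + sum h {S \<in> ?Q. P2 S} + sum h {S \<in> ?Q. P3 S} + sum h {S \<in> ?Q. P4 S}"
  proof (rule sum_le_disj4)
    fix S assume "S \<in> ?Q"
    then have "is_path_copy V 5 S" "{u, v} \<in> S" by auto
    from path5_through[OF this] show "P1 S \<or> P2 S \<or> P3 S \<or> P4 S"
      unfolding P1_def P2_def P3_def P4_def by (elim exE conjE disjE; metis)
  qed (use finite_families prod_nn in auto)
  also have "sum h {S \<in> ?Q. P1 S} \<le> (\<Sum>(x, y, z)\<in>(SIGMA x:U. SIGMA y:U. U - {x}). a x * w x y * w y z)"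
  proof (rule sum_le_family[where g = "\<lambda>(x, y, z). {{u, v}, {u, x}, {x, y}, {y, z}}"])
    fix S assume "P1 S"
    then obtain x y z where x: "{x, y, z} \<subseteq> V" "distinct [u, v, x, y, z]" and S: "S = {{u, v}, {u, x}, {x, y}, {y, z}}"
      unfolding P1_def by blast
    have hS: "h S = a x * \<nu> {x, y} * \<nu> {y, z}"
      unfolding S using x by (intro prod_remove3) (auto simp: doubleton_eq_iff)
    show "\<exists>i\<in>(SIGMA x:U. SIGMA y:U. U - {x}). (case i of (x, y, z) \<Rightarrow> {{u, v}, {u, x}, {x, y}, {y, z}}) = S
        \<and> h S \<le> (case i of (x, y, z) \<Rightarrow> a x * w x y * w y z)"
      using x by (intro bexI[of _ "(x, y, z)"]) (auto simp: hS S[symmetric])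
  qed (use fin finite_families \<nu>_nn in auto)
  also have "sum h {S \<in> ?Q. P2 S} \<le> (\<Sum>(x, y, z)\<in>(SIGMA x:U. SIGMA y:U. U - {x}). b x * w x y * w y z)"
  proof (rule sum_le_family[where g = "\<lambda>(x, y, z). {{u, v}, {v, x}, {x, y}, {y, z}}"])
    fix S assume "P2 S"
    then obtain x y z where x: "{x, y, z} \<subseteq> V" "distinct [u, v, x, y, z]" and S: "S = {{u, v}, {v, x}, {x, y}, {y, z}}"
      unfolding P2_def by blast
    have hS: "h S = b x * \<nu> {x, y} * \<nu> {y, z}"
      unfolding S using x by (intro prod_remove3) (auto simp: doubleton_eq_iff)
    show "\<exists>i\<in>(SIGMA x:U. SIGMA y:U. U - {x}). (case i of (x, y, z) \<Rightarrow> {{u, v}, {v, x}, {x, y}, {y, z}}) = S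
        \<and> h S \<le> (case i of (x, y, z) \<Rightarrow> b x * w x y * w y z)"
      using x by (intro bexI[of _ "(x, y, z)"]) (auto simp: hS S[symmetric])
  qed (use fin finite_families \<nu>_nn in auto)
  also have "sum h {S \<in> ?Q. P3 S} \<le> (\<Sum>(x, y, z)\<in>(SIGMA x:U. SIGMA y:U - {x}. U - {x}). a x * b y * w y z)"
  proof (rule sum_le_family[where g = "\<lambda>(x, y, z). {{u, v}, {u, x}, {v, y}, {y, z}}"])
    fix S assume "P3 S"
    then obtain x y z where x: "{x, y, z} \<subseteq> V" "distinct [u, v, x, y, z]" and S: "S = {{u, v}, {u, x}, {v, y}, {y, z}}"
      unfolding P3_def by blast
    have hS: "h S = a x * b y * \<nu> {y, z}"
      unfolding S using x by (intro prod_remove3) (auto simp: doubleton_eq_iff)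
    show "\<exists>i\<in>(SIGMA x:U. SIGMA y:U - {x}. U - {x}). (case i of (x, y, z) \<Rightarrow> {{u, v}, {u, x}, {v, y}, {y, z}}) = S
        \<and> h S \<le> (case i of (x, y, z) \<Rightarrow> a x * b y * w y z)"
      using x by (intro bexI[of _ "(x, y, z)"]) (auto simp: hS S[symmetric])
  qed (use fin finite_families \<nu>_nn in auto)
  also have "sum h {S \<in> ?Q. P4 S} \<le> (\<Sum>(x, y, z)\<in>(SIGMA x:U. SIGMA y:U - {x}. U - {y}). a x * b y * w x z)"
  proof (rule sum_le_family[where g = "\<lambda>(x, y, z). {{u, v}, {u, x}, {v, y}, {x, z}}"])
    fix S assume "P4 S"
    then obtain x y z where x: "{x, y, z} \<subseteq> V" "distinct [u, v, x, y, z]" and S: "S = {{u, v}, {u, x}, {v, y}, {x, z}}"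
      unfolding P4_def by blast
    have hS: "h S = a x * b y * \<nu> {x, z}"
      unfolding S using x by (intro prod_remove3) (auto simp: doubleton_eq_iff)
    show "\<exists>i\<in>(SIGMA x:U. SIGMA y:U - {x}. U - {y}). (case i of (x, y, z) \<Rightarrow> {{u, v}, {u, x}, {v, y}, {x, z}}) = S
        \<and> h S \<le> (case i of (x, y, z) \<Rightarrow> a x * b y * w x z)"
      using x by (intro bexI[of _ "(x, y, z)"]) (auto simp: hS S[symmetric])
  qed (use fin finite_families \<nu>_nn in auto)
  finally have "sum h ?Q \<le> (\<Sum>x\<in>U. \<Sum>y\<in>U. \<Sum>z\<in>U - {x}. a x * w x y * w y z)
      + (\<Sum>x\<in>U. \<Sum>y\<in>U. \<Sum>z\<in>U - {x}. b x * w x y * w y z)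
      + (\<Sum>x\<in>U. \<Sum>y\<in>U - {x}. \<Sum>z\<in>U - {x}. a x * b y * w y z)
      + (\<Sum>x\<in>U. \<Sum>y\<in>U - {x}. \<Sum>z\<in>U - {y}. a x * b y * w x z)"
    using fin by (simp only: sum_Sigma3 finite_Diff)
  then show ?thesis by (simp only: distrib_right distrib_left sum_distrib_left sum.distrib add.assoc)
qed

text \<open>The right-hand side is 2/3 for \<open>m = 3\<close> and 1/8 for \<open>m = 4\<close>.
  The equality part yields the weights on one cycle only; that nothing is left elsewhere follows
  later from the total mass.\<close>

lemma deriv_bound:
  assumes "m \<in> {3, 4}"
  defines "D \<equiv> multilin_deriv (Kedges V) (copy_coeff V m) {u, v} \<nu>"
  shows "D \<le> real m * (2 / real m ^ (m - 1))"
    and "D = real m * (2 / real m ^ (m - 1)) \<Longrightarrow>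
      \<exists>S. S \<subseteq> Kedges V \<and> is_cycle_copy V m S \<and> (\<forall>e\<in>S. \<nu> e = 1 / real m)"
proof -
  have "D \<le> real m * (2 / real m ^ (m - 1)) \<and> (D = real m * (2 / real m ^ (m - 1)) \<longrightarrow>
      (\<exists>S. S \<subseteq> Kedges V \<and> is_cycle_copy V m S \<and> (\<forall>e\<in>S. \<nu> e = 1 / real m)))"
    (is "_ \<and> (_ \<longrightarrow> ?R)")
  proof (cases "m = 3")
    case m: True
    have le: "D \<le> 6 * X3 + (\<Sum>x\<in>U. \<Sum>y\<in>U - {x}. a x * b y) + (\<Sum>x\<in>U. \<Sum>y\<in>U. (a x + b x) * w x y)"
      using cycle3_sum_le path4_sum_le unfolding D_def m copy_deriv_eq[OF fin_V] by simp
    have c: "real m * (2 / real m ^ (m - 1)) = 2 / 3" by (simp add: m)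
    have ?R if "D = 2 / 3"
    proof -
      from le that triangle_bound obtain x where "\<nu> {u, v} = 1 / 3" "x \<in> U" "a x = 1 / 3" "b x = 1 / 3"
        by (smt (verit))
      then have x: "distinct [u, v, x]" "{u, v, x} \<subseteq> V"
        and w: "\<nu> {u, v} = 1 / 3" "\<nu> {v, x} = 1 / 3" "\<nu> {x, u} = 1 / 3"
        using uv by (auto simp: insert_commute)
      let ?S = "{{u, v}, {v, x}, {x, u}}"
      have "is_cycle_copy V m ?S" unfolding m cycle3_iff using x by blast
      moreover have "?S \<subseteq> Kedges V" using x by (auto simp: doubleton_in_Kedges)
      moreover have "\<forall>e\<in>?S. \<nu> e = 1 / real m" using w m by simp
      ultimately show ?thesis by blast
    qed
    moreover have "D \<le> 2 / 3" using le triangle_bound(1) by linarith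
    ultimately show ?thesis unfolding c by blast
  next
    case False
    then have m: "m = 4" using assms by simp
    have le: "D \<le> 8 * X4 + (\<Sum>x\<in>U. \<Sum>y\<in>U. \<Sum>z\<in>U - {x}. (a x + b x) * w x y * w y z)
      + (\<Sum>x\<in>U. \<Sum>y\<in>U - {x}. a x * b y * ((\<Sum>z\<in>U - {x}. w y z) + (\<Sum>z\<in>U - {y}. w x z)))"
      using cycle4_sum_le path5_sum_le unfolding D_def m copy_deriv_eq[OF fin_V] by simp
    have c: "real m * (2 / real m ^ (m - 1)) = 1 / 8" by (simp add: m)
    have ?R if "D = 1 / 8"
    proof -
      from le that quad_bound obtain x y where xy: "\<nu> {u, v} = 1 / 4" "x \<in> U" "y \<in> U"
        "a x = 1 / 4" "w x y = 1 / 4" "b y = 1 / 4"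
        by (smt (verit))
      then have "x \<noteq> y" by auto
      with xy have x: "distinct [u, v, y, x]" "{u, v, y, x} \<subseteq> V"
        and w: "\<nu> {u, v} = 1 / 4" "\<nu> {v, y} = 1 / 4" "\<nu> {y, x} = 1 / 4" "\<nu> {x, u} = 1 / 4"
        using uv by (auto simp: insert_commute)
      let ?S = "{{u, v}, {v, y}, {y, x}, {x, u}}"
      have "is_cycle_copy V m ?S" unfolding m cycle4_iff using x by blast
      moreover have "?S \<subseteq> Kedges V" using x by (auto simp: doubleton_in_Kedges)
      moreover have "\<forall>e\<in>?S. \<nu> e = 1 / real m" using w m by simp
      ultimately show ?thesis by blast
    qed
    moreover have "D \<le> 1 / 8" using le quad_bound(1) by linarith
    ultimately show ?thesis unfolding c by blast
  qed
  then show "D \<le> real m * (2 / real m ^ (m - 1))"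
    "D = real m * (2 / real m ^ (m - 1)) \<Longrightarrow>
      \<exists>S. S \<subseteq> Kedges V \<and> is_cycle_copy V m S \<and> (\<forall>e\<in>S. \<nu> e = 1 / real m)"
    by blast+
qed

end

section \<open>From the derivative estimate to the theorem\<close>

lemma heaviest_edge_exists:
  assumes "finite V" "\<nu> \<in> prob_weights (Kedges V)"
  obtains u v where "heaviest_edge V \<nu> u v"
proof -
  have "Kedges V \<noteq> {}" using assms(2) by (auto simp: prob_weights_def)
  with finite_Kedges[OF assms(1)] obtain e where e: "e \<in> Kedges V" "Max (\<nu> ` Kedges V) = \<nu> e"
    using obtains_MAX by blast
  then obtain u v where uv: "u \<in> V" "v \<in> V" "u \<noteq> v" "e = {u, v}" unfolding Kedges_def by blast
  have "\<nu> f \<le> \<nu> {u, v}" if "f \<in> Kedges V" for f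
    using e(2) Max_ge[of "\<nu> ` Kedges V" "\<nu> f"] finite_Kedges[OF assms(1)] that uv(4) by auto
  with assms uv have "heaviest_edge V \<nu> u v" by unfold_locales auto
  then show ?thesis by (rule that)
qed

text \<open>The chain is \<open>m * F \<le> D \<le> m * (2 / m ^ (m - 1))\<close>, with
  \<open>D\<close> the derivative at a heaviest edge. If \<open>F\<close> attains its bound, both
  links are tight and the equality case for \<open>D\<close> applies.\<close>

lemma maximum_bound:
  assumes "finite V" "m \<in> {3, 4}" and \<nu>: "\<nu> \<in> prob_weights (Kedges V)"
    and opt: "\<And>\<rho>. \<rho> \<in> prob_weights (Kedges V) \<Longrightarrow>
      multilin (Kedges V) (copy_coeff V m) \<rho> \<le> multilin (Kedges V) (copy_coeff V m) \<nu>"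
  defines "F \<equiv> multilin (Kedges V) (copy_coeff V m) \<nu>"
  shows "F \<le> 2 / real m ^ (m - 1)"
    and "F = 2 / real m ^ (m - 1) \<Longrightarrow>
      \<exists>S. S \<subseteq> Kedges V \<and> is_cycle_copy V m S \<and> (\<forall>e\<in>S. \<nu> e = 1 / real m)"
proof -
  obtain u v where "heaviest_edge V \<nu> u v" using heaviest_edge_exists[OF assms(1) \<nu>] .
  then interpret heaviest_edge V \<nu> u v .
  have F: "real m * F \<le> multilin_deriv (Kedges V) (copy_coeff V m) {u, v} \<nu>"
    unfolding F_def using copy_coeff_homogeneous[OF assms(2)] finite_Kedges[OF assms(1)] \<nu> opt uv max_pos
    by (intro multilin_le_deriv_of_max) (auto simp: doubleton_in_Kedges)
  then have "real m * F \<le> real m * (2 / real m ^ (m - 1))"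
    using deriv_bound(1)[OF assms(2)] by linarith
  then show "F \<le> 2 / real m ^ (m - 1)"
    using assms(2) by (auto simp: mult_le_cancel_left)
  assume "F = 2 / real m ^ (m - 1)"
  then show "\<exists>S. S \<subseteq> Kedges V \<and> is_cycle_copy V m S \<and> (\<forall>e\<in>S. \<nu> e = 1 / real m)"
    using F deriv_bound[OF assms(2)] by (metis order_antisym)
qed

text \<open>The \<open>m\<close> edges of weight \<open>1 / m\<close> exhaust the total mass, so all
  other edges have weight 0. The cycle \<open>S\<close> alone contributes
  \<open>2 * m * (1 / m) ^ m\<close>, already the claimed bound, and the remaining terms are
  nonnegative.\<close>

lemma uniform_on_cycle:
  assumes "finite V" "m \<in> {3, 4}" and sum: "sum \<mu> (Kedges V) = 1" and nn: "\<And>e. e \<in> Kedges V \<Longrightarrow> 0 \<le> \<mu> e"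
    and S: "S \<subseteq> Kedges V" "is_cycle_copy V m S" "\<And>e. e \<in> S \<Longrightarrow> \<mu> e = 1 / real m"
  shows "\<forall>e\<in>Kedges V. \<mu> e = (if e \<in> S then 1 / real m else 0)"
    and "2 / real m ^ (m - 1) \<le> multilin (Kedges V) (copy_coeff V m) \<mu>"
proof -
  note fin = finite_Kedges[OF assms(1)]
  have c: "2 * real m \<le> copy_coeff V m S" using S(2) by (simp add: copy_coeff_def)
  have m: "0 < m" using assms(2) by auto
  with c have card: "card S = m" by (intro copy_coeff_homogeneous[OF assms(2), of V]) auto
  have "sum \<mu> S = 1" using S(3) card m by simp
  then have "sum \<mu> (Kedges V - S) = 0"
    using sum sum.subset_diff[OF S(1) fin, of \<mu>] by simp
  then have "\<forall>e\<in>Kedges V - S. \<mu> e = 0"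
    using fin nn by (subst (asm) sum_nonneg_eq_0_iff) auto
  then show "\<forall>e\<in>Kedges V. \<mu> e = (if e \<in> S then 1 / real m else 0)"
    using S(3) by auto
  have "prod \<mu> S = (1 / real m) ^ m" using S(3) card by simp
  moreover have "(1 / real m) ^ m = 1 / real m ^ (m - 1) / real m"
    using m power_minus_mult[of m "1 / real m"] by (simp add: power_one_over)
  ultimately have "2 / real m ^ (m - 1) = 2 * real m * prod \<mu> S"
    using m by simp
  also have "\<dots> \<le> copy_coeff V m S * prod \<mu> S"
    using c S(3) by (intro mult_right_mono prod_nonneg) auto
  also have "\<dots> \<le> multilin (Kedges V) (copy_coeff V m) \<mu>"
    unfolding multilin_def using S(1) fin nn
    by (intro member_le_sum[of S "Pow (Kedges V)" "\<lambda>S. copy_coeff V m S * prod \<mu> S"])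
      (auto simp: copy_coeff_def intro!: mult_nonneg_nonneg prod_nonneg)
  finally show "2 / real m ^ (m - 1) \<le> multilin (Kedges V) (copy_coeff V m) \<mu>" .
qed

theorem theorem4p6:
  fixes V :: "'a set" and \<mu> :: "'a set \<Rightarrow> real" and m :: nat
  assumes "m \<in> {3, 4}"
    and "edge_prob_measure V \<mu>"
  shows "2 * real m * beta V \<mu> (is_cycle_copy V m) + beta V \<mu> (is_path_copy V (m + 1))
           \<le> 2 / real m ^ (m - 1)
       \<and> (2 * real m * beta V \<mu> (is_cycle_copy V m) + beta V \<mu> (is_path_copy V (m + 1))
           = 2 / real m ^ (m - 1)
         \<longleftrightarrow> (\<exists>S. S \<subseteq> Kedges V \<and> is_cycle_copy V m S \<and>
                (\<forall>e \<in> Kedges V. \<mu> e = (if e \<in> S then 1 / real m else 0))))"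
proof -
  have V: "finite V" and nn: "\<And>e. e \<in> Kedges V \<Longrightarrow> 0 \<le> \<mu> e" and sum: "sum \<mu> (Kedges V) = 1"
    using assms(2) by (auto simp: edge_prob_measure_def)
  let ?F = "multilin (Kedges V) (copy_coeff V m)" and ?c = "2 / real m ^ (m - 1)"
  \<comment> \<open>Off \<open>Kedges V\<close> the values of \<mu> are arbitrary, while
    \<open>prob_weights\<close> demands 0 there; the form sees only the edges, so its value is
    unchanged.\<close>
  define \<nu> where "\<nu> e = (if e \<in> Kedges V then \<mu> e else 0)" for e
  have \<nu>: "\<nu> \<in> prob_weights (Kedges V)"
    using nn sum by (simp add: prob_weights_def \<nu>_def)
  have F: "?F \<mu> = ?F \<nu>" by (rule multilin_cong) (simp add: \<nu>_def)
  obtain \<rho> where \<rho>: "\<rho> \<in> prob_weights (Kedges V)" "\<And>\<sigma>. \<sigma> \<in> prob_weights (Kedges V) \<Longrightarrow> ?F \<sigma> \<le> ?F \<rho>"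
    using multilin_attains_max[OF finite_Kedges[OF V] \<nu>] by metis
  have bound: "?F \<sigma> \<le> ?c" if "\<sigma> \<in> prob_weights (Kedges V)" for \<sigma>
    using \<rho>(2)[OF that] maximum_bound(1)[OF V assms(1) \<rho>] by simp
  have "\<exists>S. S \<subseteq> Kedges V \<and> is_cycle_copy V m S \<and>
      (\<forall>e \<in> Kedges V. \<mu> e = (if e \<in> S then 1 / real m else 0))" if eq: "?F \<nu> = ?c"
  proof -
    obtain S where S: "S \<subseteq> Kedges V" "is_cycle_copy V m S" "\<forall>e\<in>S. \<nu> e = 1 / real m"
      using maximum_bound(2)[OF V assms(1) \<nu> _ eq] bound eq by auto
    then have "\<mu> e = 1 / real m" if "e \<in> S" for e
      using S(1,3) that by (metis \<nu>_def subsetD)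
    from uniform_on_cycle(1)[OF V assms(1) sum nn S(1,2) this] S show ?thesis by blast
  qed
  moreover have "?F \<nu> = ?c" if "S \<subseteq> Kedges V" "is_cycle_copy V m S"
    "\<forall>e \<in> Kedges V. \<mu> e = (if e \<in> S then 1 / real m else 0)" for S
  proof -
    have "\<mu> e = 1 / real m" if "e \<in> S" for e
      using \<open>S \<subseteq> Kedges V\<close> that \<open>\<forall>e\<in>Kedges V. _ e\<close> by auto
    from uniform_on_cycle(2)[OF V assms(1) sum nn that(1,2) this] bound[OF \<nu>] F
    show ?thesis by simp
  qed
  ultimately show ?thesis
    unfolding beta_eq[OF V] F using bound[OF \<nu>] by blast
qed

end
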